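(* Let $q\ge2$ be an integer and let $(X_\sigma)_{\sigma\in T(q;1)}$ be a branching-type stationary stochastic process on $T(q;1)$ with spectral measure $\mu$. Then $$d_{L^2}\left(X_e,\ \overline{\mathrm{span}}^{L^2}\big\{X_\sigma:\sigma\in T(q;1)\setminus\{e\}\big\}\right)=\sqrt{\,q\exp\left(\int_{\mathbb{T}}\log\Big(\frac{d\mu_{ac}}{dm}\Big)dm\right)-(q-1)\,\mu(\mathbb{T})\,},$$ where $\mu_{ac}$ is the absolutely continuous part of $\mu$ with respect to the normalized Haar measure $m$ on $\mathbb{T}$.
   Context: $\mathbb{N}=\{0,1,2,\dots\}$, $\mathbb{T}=\mathbb{R}/2\pi\mathbb{Z}$. $T(q;1)$ is the rooted tree whose root $e$ has exactly $q$ children and in which every other vertex has exactly one child. A rooted geodesic ray is an infinite geodesic $\xi=(\sigma_n)_{n\in\mathbb{N}}$ with $\sigma_0=e$, identified with $\mathbb{N}$. Two vertices are comparable if they lie on a common rooted geodesic ray. For mean-zero complex random variables, $\mathrm{Cov}(X,Y)=\mathbb{E}(X\overline{Y})$. A mean-zero square-integrable process $(X_n)_{n\in\mathbb{N}}$ is (weakly) stationary if $\mathrm{Cov}(X_n,X_{n+k})$ does not depend on $n$; its spectral measure is the unique positive Radon measure $\nu$ on $\mathbb{T}$ with $\mathrm{Cov}(X_n,X_{n+k})=\int_{\mathbb{T}}e^{-ik\theta}d\nu(\theta)$ for all $n,k\in\mathbb{N}$. A mean-zero square-integrable process $(X_\sigma)_{\sigma\in T}$ on a rooted tree $T$ is a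 branching-type stationary stochastic process if (i) its restriction to every rooted geodesic ray is stationary; (ii) all these restrictions share the same spectral measure, called the spectral measure of the process; (iii) $\mathrm{Cov}(X_\sigma,X_\tau)=0$ for all non-comparable $\sigma,\tau$. $d_{L^2}$ denotes the distance in the $L^2$ space of the underlying probability space, and $\overline{\mathrm{span}}^{L^2}$ the closed linear span there. *)

theory Defs
  imports "HOL-Probability.Probability"
begin

section \<open>Rooted trees\<close>

text \<open>
  A rooted tree is given by a prefix-closed set \<open>V\<close> of words over the natural numbers
  (Ulam-Harris labelling): the root is the empty word and the children of \<open>u\<close> are the words
  \<open>u @ [i]\<close> belonging to \<open>V\<close>.
\<close>

definition children :: "nat list set \<Rightarrow> nat list \<Rightarrow> nat list set" where
  "children V u = {v \<in> V. \<exists>i. v = u @ [i]}"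

definition tree_adj :: "nat list set \<Rightarrow> nat list \<Rightarrow> nat list \<Rightarrow> bool" where
  "tree_adj V u v \<longleftrightarrow> u \<in> V \<and> v \<in> V \<and> (v \<in> children V u \<or> u \<in> children V v)"

definition tree_dist :: "nat list set \<Rightarrow> nat list \<Rightarrow> nat list \<Rightarrow> nat" where
  "tree_dist V u v = (LEAST n. (tree_adj V ^^ n) u v)"

definition rooted_rays :: "nat list set \<Rightarrow> (nat \<Rightarrow> nat list) set" where
  "rooted_rays V = {\<xi>. range \<xi> \<subseteq> V \<and> \<xi> 0 = [] \<and>
     (\<forall>m n. int (tree_dist V (\<xi> m) (\<xi> n)) = \<bar>int m - int n\<bar>)}"

definition comparable :: "nat list set \<Rightarrow> nat list \<Rightarrow> nat list \<Rightarrow> bool" where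
  "comparable V u v \<longleftrightarrow> (\<exists>\<xi>\<in>rooted_rays V. u \<in> range \<xi> \<and> v \<in> range \<xi>)"

text \<open>The tree \<open>T(q;1)\<close>: the vertex at level \<open>n + 1\<close> of branch \<open>i\<close> is \<open>i # replicate n 0\<close>.\<close>

definition tree_q1 :: "nat \<Rightarrow> nat list set" where
  "tree_q1 q = insert [] {i # replicate n 0 | i n. i < q}"

lemma tree_q1_prefix_closed: "u @ v \<in> tree_q1 q \<Longrightarrow> u \<in> tree_q1 q"
proof -
  assume "u @ v \<in> tree_q1 q"
  then consider "u = []" | i n w where "i < q" "u = i # w" "w @ v = replicate n 0"
    by (cases u) (auto simp: tree_q1_def)
  then show ?thesis
  proof cases
    case 2
    then have "w = replicate (length w) 0"
      by (metis append_eq_conv_conj take_replicate length_take length_replicate)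
    with 2 show ?thesis by (auto simp: tree_q1_def)
  qed (auto simp: tree_q1_def)
qed

lemma card_children_root: "card (children (tree_q1 q) []) = q"
proof -
  have "children (tree_q1 q) [] = (\<lambda>i. [i]) ` {..<q}"
    by (auto simp: children_def tree_q1_def image_iff)
  then show ?thesis by (simp add: card_image inj_on_def)
qed

lemma card_children_nonroot:
  assumes "u \<in> tree_q1 q" "u \<noteq> []"
  shows "card (children (tree_q1 q) u) = 1"
proof -
  from assms obtain i n where u: "u = i # replicate n 0" "i < q"
    by (auto simp: tree_q1_def)
  have "replicate n 0 @ [j] = replicate k 0 \<longleftrightarrow> j = 0 \<and> k = Suc n" for j k :: nat
  proof
    assume *: "replicate n 0 @ [j] = replicate k 0"
    have "length (replicate n 0 @ [j]) = k" unfolding * by (rule length_replicate)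
    moreover have "j \<in> set (replicate k 0)" unfolding *[symmetric] by simp
    ultimately show "j = 0 \<and> k = Suc n" by simp
  next
    assume "j = 0 \<and> k = Suc n"
    then show "replicate n 0 @ [j] = replicate k 0" by (metis replicate_append_same replicate_Suc)
  qed
  then have "children (tree_q1 q) u = {u @ [0]}"
    unfolding children_def tree_q1_def u(1) using u(2) by auto
  then show ?thesis by simp
qed

section \<open>The circle\<close>

text \<open>
  The circle \<open>\<real>/2\<pi>\<int>\<close> is represented by its fundamental domain \<open>[0, 2\<pi>)\<close>; the quotient map
  identifies the two Borel sigma-algebras. As the circle is compact and metrizable, its positive
  Radon measures are its finite Borel measures.
\<close>

definition radon_measure_circle :: "real measure \<Rightarrow> bool" where
  "radon_measure_circle \<nu> \<longleftrightarrow>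
     finite_measure \<nu> \<and> sets \<nu> = sets (restrict_space borel {0..<2 * pi})"

definition haar_circle :: "real measure" where
  "haar_circle = scale_measure (ennreal (1 / (2 * pi))) (restrict_space lborel {0..<2 * pi})"

lemma haar_circle_radon: "radon_measure_circle haar_circle"
  and emeasure_haar_circle_space: "emeasure haar_circle (space haar_circle) = 1"
proof -
  have "emeasure haar_circle (space haar_circle) = ennreal (1 / (2 * pi)) * ennreal (2 * pi)"
    by (simp add: haar_circle_def space_scale_measure emeasure_restrict_space space_restrict_space)
  also have "\<dots> = 1"
    by (subst ennreal_mult[symmetric]) auto
  finally show *: "emeasure haar_circle (space haar_circle) = 1" .
  show "radon_measure_circle haar_circle"
    unfolding radon_measure_circle_def using *
    by (auto intro!: finite_measureI simp: haar_circle_def sets_restrict_space)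
qed

section \<open>Lebesgue decomposition\<close>

definition mutually_singular :: "'a measure \<Rightarrow> 'a measure \<Rightarrow> bool" where
  "mutually_singular M S \<longleftrightarrow>
     (\<exists>B\<in>sets M. emeasure M B = 0 \<and> emeasure S (space M - B) = 0)"

definition lebesgue_decomposition ::
    "'a measure \<Rightarrow> 'a measure \<Rightarrow> 'a measure \<Rightarrow> 'a measure \<Rightarrow> bool" where
  "lebesgue_decomposition M N A S \<longleftrightarrow>
     sets A = sets M \<and> sets S = sets M \<and>
     absolutely_continuous M A \<and> mutually_singular M S \<and>
     (\<forall>E\<in>sets M. emeasure N E = emeasure A E + emeasure S E)"

definition ac_part :: "'a measure \<Rightarrow> 'a measure \<Rightarrow> 'a measure" where
  "ac_part M N = (THE A. \<exists>S. lebesgue_decomposition M N A S)"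

lemma lebesgue_decomposition_exists:
  assumes "finite_measure N" and sets_N: "sets N = sets M"
  shows "\<exists>A S. lebesgue_decomposition M N A S"
proof -
  interpret N: finite_measure N by fact
  have sp: "space N = space M" using sets_N by (rule sets_eq_imp_space_eq)
  have "null_sets M \<noteq> {}" by auto
  then obtain f where f: "range f \<subseteq> emeasure N ` null_sets M"
    and sup_f: "Sup (emeasure N ` null_sets M) = (SUP i::nat. f i)"
    using ennreal_SUP_countable_SUP[of "null_sets M" "emeasure N"] by blast
  then have "\<forall>i. \<exists>B. B \<in> null_sets M \<and> f i = emeasure N B" by blast
  then obtain C where C: "\<And>i. C i \<in> null_sets M" "\<And>i. f i = emeasure N (C i)" by metis
  define B where "B = (\<Union>i. C i)"
  have B: "B \<in> null_sets M" unfolding B_def using C by auto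
  then have BM[measurable]: "B \<in> sets M" and BN[measurable]: "B \<in> sets N"
    using sets_N by auto
  have f_le: "f i \<le> emeasure N B" for i
    unfolding C using BN by (intro emeasure_mono) (auto simp: B_def)
  then have le: "emeasure N E \<le> emeasure N B" if "E \<in> null_sets M" for E
  proof -
    have "emeasure N E \<le> Sup (emeasure N ` null_sets M)" using that by (intro SUP_upper)
    also have "\<dots> \<le> emeasure N B" unfolding sup_f by (intro SUP_least f_le)
    finally show ?thesis .
  qed
  have null: "emeasure N (E - B) = 0" if E: "E \<in> null_sets M" for E
  proof -
    have [measurable]: "E \<in> sets N" using E sets_N by auto
    have "emeasure N B + emeasure N (E - B) = emeasure N (B \<union> (E - B))"
      by (intro plus_emeasure) auto
    also have "B \<union> (E - B) = B \<union> E" by auto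
    also have "emeasure N (B \<union> E) \<le> emeasure N B" using B E by (intro le) auto
    finally have "emeasure N B + emeasure N (E - B) \<le> emeasure N B + 0" by simp
    then show ?thesis
      using N.emeasure_finite[of B] by (simp only: ennreal_add_left_cancel_le) simp
  qed
  define A where "A = density N (indicator (space M - B))"
  define S where "S = density N (indicator B)"
  have eA: "emeasure A E = emeasure N (E - B)" if "E \<in> sets M" for E
  proof -
    have [measurable]: "E \<in> sets N" using that sets_N by simp
    have "emeasure A E = (\<integral>\<^sup>+x. indicator (space M - B) x * indicator E x \<partial>N)"
      unfolding A_def sp[symmetric] by (subst emeasure_density) auto
    also have "\<dots> = (\<integral>\<^sup>+x. indicator (E - B) x \<partial>N)"
      by (intro nn_integral_cong) (simp add: sp split: split_indicator)
    finally have "emeasure A E = (\<integral>\<^sup>+x. indicator (E - B) x \<partial>N)" .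
    then show ?thesis by simp
  qed
  have eS: "emeasure S E = emeasure N (E \<inter> B)" if "E \<in> sets M" for E
  proof -
    have [measurable]: "E \<in> sets N" using that sets_N by simp
    have "emeasure S E = (\<integral>\<^sup>+x. indicator B x * indicator E x \<partial>N)"
      unfolding S_def by (subst emeasure_density) auto
    also have "\<dots> = (\<integral>\<^sup>+x. indicator (E \<inter> B) x \<partial>N)"
      by (intro nn_integral_cong) (simp split: split_indicator)
    finally have "emeasure S E = (\<integral>\<^sup>+x. indicator (E \<inter> B) x \<partial>N)" .
    then show ?thesis by simp
  qed
  have "lebesgue_decomposition M N A S"
    unfolding lebesgue_decomposition_def
  proof (intro conjI ballI)
    show "sets A = sets M" "sets S = sets M" by (simp_all add: A_def S_def sets_N)
    then show "absolutely_continuous M A"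
      unfolding absolutely_continuous_def using null eA by (auto simp: null_sets_def)
    have "emeasure S (space M - B) = 0"
      by (subst eS) (auto simp: Diff_Int_distrib2)
    then show "mutually_singular M S"
      unfolding mutually_singular_def using B by (auto intro!: bexI[of _ B])
    fix E assume E: "E \<in> sets M"
    then have "emeasure N ((E - B) \<union> (E \<inter> B)) = emeasure N (E - B) + emeasure N (E \<inter> B)"
      using BN sets_N by (intro plus_emeasure[symmetric]) auto
    moreover have "(E - B) \<union> (E \<inter> B) = E" by auto
    ultimately show "emeasure N E = emeasure A E + emeasure S E" using eA eS E by simp
  qed
  then show ?thesis by blast
qed

lemma lebesgue_decomposition_unique:
  assumes "lebesgue_decomposition M N A S" "lebesgue_decomposition M N A' S'"
  shows "A = A'"
proof -
  obtain B where B: "B \<in> sets M" "emeasure M B = 0" "emeasure S (space M - B) = 0"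
    using assms unfolding lebesgue_decomposition_def mutually_singular_def by auto
  obtain B' where B': "B' \<in> sets M" "emeasure M B' = 0" "emeasure S' (space M - B') = 0"
    using assms unfolding lebesgue_decomposition_def mutually_singular_def by auto
  have C: "B \<union> B' \<in> null_sets M" using B B' by (intro null_sets.Un null_setsI)
  have key: "emeasure A0 E = emeasure N (E - (B \<union> B'))"
    if dec: "lebesgue_decomposition M N A0 S0" and E: "E \<in> sets M"
      and D: "D \<in> sets M" "emeasure S0 (space M - D) = 0" "D \<subseteq> B \<union> B'" for A0 S0 D E
  proof -
    have s: "sets A0 = sets M" "sets S0 = sets M"
      using dec by (auto simp: lebesgue_decomposition_def)
    have "B \<union> B' \<in> null_sets A0"
      using C dec by (auto simp: lebesgue_decomposition_def absolutely_continuous_def)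
    then have "emeasure A0 E = emeasure A0 (E - (B \<union> B'))"
      using E s by (intro emeasure_Diff_null_set[symmetric]) auto
    moreover have "emeasure S0 (E - (B \<union> B')) \<le> emeasure S0 (space M - D)"
      using D E s sets.sets_into_space[OF E] by (intro emeasure_mono) auto
    moreover have "emeasure N (E - (B \<union> B'))
        = emeasure A0 (E - (B \<union> B')) + emeasure S0 (E - (B \<union> B'))"
      using dec E B B' by (auto simp: lebesgue_decomposition_def)
    ultimately show ?thesis using D by simp
  qed
  show ?thesis
  proof (rule measure_eqI)
    show "sets A = sets A'" using assms by (auto simp: lebesgue_decomposition_def)
    fix E assume "E \<in> sets A"
    then have "E \<in> sets M" using assms by (auto simp: lebesgue_decomposition_def)
    then show "emeasure A E = emeasure A' E"
      using key[OF assms(1) _ B(1,3)] key[OF assms(2) _ B'(1,3)] by simp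
  qed
qed

lemma ac_part_decomposition:
  assumes "finite_measure N" "sets N = sets M"
  shows "\<exists>S. lebesgue_decomposition M N (ac_part M N) S"
proof -
  have "\<exists>!A. \<exists>S. lebesgue_decomposition M N A S"
    using lebesgue_decomposition_exists[OF assms] lebesgue_decomposition_unique by blast
  then show ?thesis unfolding ac_part_def by (rule theI')
qed

section \<open>Extended-valued logarithm, integral and exponential\<close>

text \<open>
  The logarithm of a density may take the value \<open>-\<infinity>\<close> and its integral may be \<open>-\<infinity>\<close>, with
  \<open>exp (-\<infinity>) = 0\<close>. The Bochner integral, which is 0 on non-integrable functions, would be wrong
  here.
\<close>

definition ext_log :: "ennreal \<Rightarrow> ereal" where
  "ext_log x = (if x = 0 then -\<infinity> else if x = \<infinity> then \<infinity> else ereal (ln (enn2real x)))"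

definition ext_integral :: "'a measure \<Rightarrow> ('a \<Rightarrow> ereal) \<Rightarrow> ereal" where
  "ext_integral M f =
     enn2ereal (\<integral>\<^sup>+x. e2ennreal (f x) \<partial>M) - enn2ereal (\<integral>\<^sup>+x. e2ennreal (- f x) \<partial>M)"

definition ext_exp :: "ereal \<Rightarrow> ereal" where
  "ext_exp x = (case x of ereal r \<Rightarrow> ereal (exp r) | PInfty \<Rightarrow> \<infinity> | MInfty \<Rightarrow> 0)"

text \<open>
  For a density with finite integral the positive part of the logarithm is integrable, so its
  integral is well defined in \<open>[-\<infinity>, \<infinity>)\<close> and its exponential is a real number.
\<close>

lemma ext_integral_log_less_top:
  assumes "(\<integral>\<^sup>+x. f x \<partial>M) < \<infinity>"
  shows "(\<integral>\<^sup>+x. e2ennreal (ext_log (f x)) \<partial>M) < \<infinity>" (is ?A)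
    and "ext_integral M (\<lambda>x. ext_log (f x)) < \<infinity>" (is ?B)
proof -
  have "e2ennreal (ext_log y) \<le> y" for y
  proof (cases y)
    case (real r)
    show ?thesis
    proof (cases "r = 0")
      case False
      with real have "0 < r" by simp
      then have "ln r \<le> r" using ln_bound by blast
      with real False \<open>0 < r\<close> show ?thesis
        by (simp add: ext_log_def ennreal_leI flip: ennreal.abs_eq)
    qed (use real in \<open>simp add: ext_log_def e2ennreal_neg\<close>)
  qed simp
  then show A: ?A
    by (intro le_less_trans[OF nn_integral_mono assms])
  have "enn2ereal a - enn2ereal b < \<infinity>" if "a < \<infinity>" for a b :: ennreal
    using that by (cases a; cases b) (auto simp: enn2ereal_ennreal)
  then show ?B unfolding ext_integral_def using A by blast
qed

lemma ext_integral_log_ac_part_less_top: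
  assumes "radon_measure_circle \<mu>"
  shows "ext_integral haar_circle
    (\<lambda>\<theta>. ext_log (RN_deriv haar_circle (ac_part haar_circle \<mu>) \<theta>)) < \<infinity>"
proof (rule ext_integral_log_less_top)
  interpret m: finite_measure haar_circle
    using haar_circle_radon by (simp add: radon_measure_circle_def)
  interpret \<mu>: finite_measure \<mu>
    using assms by (simp add: radon_measure_circle_def)
  have s: "sets \<mu> = sets haar_circle"
    using assms haar_circle_radon by (simp add: radon_measure_circle_def)
  let ?A = "ac_part haar_circle \<mu>"
  obtain S where S: "lebesgue_decomposition haar_circle \<mu> ?A S"
    using ac_part_decomposition[OF _ s] \<mu>.finite_measure_axioms by blast
  have d: "density haar_circle (RN_deriv haar_circle ?A) = ?A"
    using S by (intro m.density_RN_deriv) (auto simp: lebesgue_decomposition_def)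
  have "(\<integral>\<^sup>+x. RN_deriv haar_circle ?A x \<partial>haar_circle)
      = emeasure (density haar_circle (RN_deriv haar_circle ?A)) (space haar_circle)"
    by (subst emeasure_density) (auto intro!: nn_integral_cong)
  also have "\<dots> \<le> emeasure \<mu> (space haar_circle)"
    unfolding d using S by (auto simp: lebesgue_decomposition_def)
  also have "\<dots> < \<infinity>" using \<mu>.emeasure_finite[of "space haar_circle"] by (simp add: less_top[symmetric])
  finally show "(\<integral>\<^sup>+x. RN_deriv haar_circle ?A x \<partial>haar_circle) < \<infinity>" .
qed

section \<open>Square-integrable random variables\<close>

definition L2_space :: "'w measure \<Rightarrow> ('w \<Rightarrow> complex) set" where
  "L2_space P = {f \<in> borel_measurable P. integrable P (\<lambda>\<omega>. (cmod (f \<omega>))\<^sup>2)}"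

definition L2_dist :: "'w measure \<Rightarrow> ('w \<Rightarrow> complex) \<Rightarrow> ('w \<Rightarrow> complex) \<Rightarrow> real" where
  "L2_dist P f g = sqrt (\<integral>\<omega>. (cmod (f \<omega> - g \<omega>))\<^sup>2 \<partial>P)"

definition lin_span :: "('w \<Rightarrow> complex) set \<Rightarrow> ('w \<Rightarrow> complex) set" where
  "lin_span S = {(\<lambda>\<omega>. \<Sum>f\<in>F. c f * f \<omega>) | F c. finite F \<and> F \<subseteq> S}"

definition L2_closed_span :: "'w measure \<Rightarrow> ('w \<Rightarrow> complex) set \<Rightarrow> ('w \<Rightarrow> complex) set" where
  "L2_closed_span P S = {f \<in> L2_space P. \<forall>\<epsilon>>0. \<exists>g\<in>lin_span S. L2_dist P f g < \<epsilon>}"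

definition L2_setdist :: "'w measure \<Rightarrow> ('w \<Rightarrow> complex) \<Rightarrow> ('w \<Rightarrow> complex) set \<Rightarrow> real" where
  "L2_setdist P f S = (INF g\<in>S. L2_dist P f g)"

section \<open>Stationary and branching-type stationary processes\<close>

definition mean_zero_L2 :: "'w measure \<Rightarrow> ('w \<Rightarrow> complex) \<Rightarrow> bool" where
  "mean_zero_L2 P f \<longleftrightarrow> f \<in> L2_space P \<and> (\<integral>\<omega>. f \<omega> \<partial>P) = 0"

definition Cov :: "'w measure \<Rightarrow> ('w \<Rightarrow> complex) \<Rightarrow> ('w \<Rightarrow> complex) \<Rightarrow> complex" where
  "Cov P f g = (\<integral>\<omega>. f \<omega> * cnj (g \<omega>) \<partial>P)"

definition stationary :: "'w measure \<Rightarrow> (nat \<Rightarrow> 'w \<Rightarrow> complex) \<Rightarrow> bool" where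
  "stationary P Y \<longleftrightarrow> (\<forall>n. mean_zero_L2 P (Y n)) \<and>
     (\<forall>n n' k. Cov P (Y n) (Y (n + k)) = Cov P (Y n') (Y (n' + k)))"

definition is_spectral_measure ::
    "'w measure \<Rightarrow> (nat \<Rightarrow> 'w \<Rightarrow> complex) \<Rightarrow> real measure \<Rightarrow> bool" where
  "is_spectral_measure P Y \<nu> \<longleftrightarrow> radon_measure_circle \<nu> \<and>
     (\<forall>n k. Cov P (Y n) (Y (n + k)) = (\<integral>\<theta>. exp (- (\<i> * of_nat k * of_real \<theta>)) \<partial>\<nu>))"

definition has_spectral_measure ::
    "'w measure \<Rightarrow> nat list set \<Rightarrow> (nat list \<Rightarrow> 'w \<Rightarrow> complex) \<Rightarrow> real measure \<Rightarrow> bool" where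
  "has_spectral_measure P V X \<nu> \<longleftrightarrow>
     (\<forall>\<xi>\<in>rooted_rays V. is_spectral_measure P (\<lambda>n. X (\<xi> n)) \<nu>)"

definition branching_stationary ::
    "'w measure \<Rightarrow> nat list set \<Rightarrow> (nat list \<Rightarrow> 'w \<Rightarrow> complex) \<Rightarrow> bool" where
  "branching_stationary P V X \<longleftrightarrow>
     (\<forall>\<sigma>\<in>V. mean_zero_L2 P (X \<sigma>)) \<and>
     (\<forall>\<xi>\<in>rooted_rays V. stationary P (\<lambda>n. X (\<xi> n))) \<and>
     (\<exists>\<nu>. has_spectral_measure P V X \<nu>) \<and>
     (\<forall>\<sigma>\<in>V. \<forall>\<tau>\<in>V. \<not> comparable V \<sigma> \<tau> \<longrightarrow> Cov P (X \<sigma>) (X \<tau>) = 0)"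

end

theory Submission
  imports Defs
begin

text \<open>
  The distance is that of linear prediction, and it splits into two independent facts.

  \<^emph>\<open>Reduction to one branch.\<close> Removing the root leaves \<open>q\<close> rays, and vertices on different rays are not
  comparable, so the variables on different rays are orthogonal. If \<open>g i\<close> is a combination of the
  variables on ray \<open>i\<close>, expanding the square gives
  \<open>\<parallel>X e - (\<Sum>i. g i)\<parallel>\<^sup>2 = (\<Sum>i. \<parallel>X e - g i\<parallel>\<^sup>2) - (q - 1) \<parallel>X e\<parallel>\<^sup>2\<close>
  (\<open>orthogonal_sum_distance\<close>, \<open>root_distance_to_branches\<close>). The \<open>g i\<close> vary independently, and
  \<open>\<parallel>X e\<parallel>\<^sup>2\<close> is the total mass of \<open>\<mu>\<close>, so the squared distance is \<open>q S - (q - 1) \<mu>(T)\<close>, where \<open>S\<close> is the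
  squared distance of the root from the rest of a single ray. As a ray is a stationary sequence
  with spectral measure \<open>\<mu>\<close>, \<open>S\<close> is the infimum of \<open>\<integral>|p|\<^sup>2 d\<mu>\<close> over polynomials with \<open>p(0) = 1\<close>
  (\<open>branch_isometry\<close>).

  \<^emph>\<open>Szego's theorem.\<close> This infimum equals \<open>exp (\<integral> log w dm)\<close>, where \<open>w\<close> is the density of the
  absolutely continuous part. The argument rests on real parts \<open>Re h\<close> of polynomials. For these
  \<open>F = exp ((h - h(0)) / 2)\<close> is analytic with \<open>F(0) = 1\<close> and \<open>|F|\<^sup>2 = exp (Re h - \<integral> Re h dm)\<close> on the circle.
  The mean value property gives \<open>\<integral>|p F|\<^sup>2 dm \<ge> 1\<close>, that is
  \<open>\<integral>|p|\<^sup>2 exp (Re h) dm \<ge> exp (\<integral> Re h dm)\<close>; on the other hand, partial sums of the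
  exponential series turn \<open>F\<close> into a limit of admissible polynomials \<open>p\<close>, which shows \<open>S \<le> exp (- \<integral> Re h dm) \<integral> exp (Re h) d\<mu>\<close>. Functions \<open>Re h\<close> are
  dense, boundedly and in \<open>L\<^sup>1(m + \<mu>)\<close>, in the bounded Borel functions \<open>g\<close>, so both inequalities
  hold for \<open>g\<close> in place of \<open>Re h\<close> (\<open>weighted_L2_lower_bound\<close>, \<open>poly_L2_upper_bound\<close>). The lower bound
  then follows with \<open>g\<close> a truncation of \<open>log w\<close>, and the upper bound with \<open>g\<close> a truncation of \<open>- log w\<close> that
  is replaced by a large negative constant on the \<open>m\<close>-null set carrying the singular part
  (\<open>szego_lower_bound\<close>, \<open>szego_upper_bound\<close>).
\<close>

section \<open>Continuous functions are dense in the integrable functions\<close>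

text \<open>
  Approximation is needed in \<open>L\<^sup>1\<close> of two measures at once, the spectral measure and Haar
  measure. It is obtained in \<open>L\<^sup>1\<close> of their sum, which dominates both.
\<close>

definition sum_measure :: "'a measure \<Rightarrow> 'a measure \<Rightarrow> 'a measure" where
  "sum_measure M N = measure_of (space M) (sets M) (\<lambda>A. emeasure M A + emeasure N A)"

lemma sets_sum_measure [simp]: "sets (sum_measure M N) = sets M"
  and space_sum_measure [simp]: "space (sum_measure M N) = space M"
  unfolding sum_measure_def by simp_all

lemma emeasure_sum_measure:
  assumes "sets N = sets M" "A \<in> sets M"
  shows "emeasure (sum_measure M N) A = emeasure M A + emeasure N A"
proof (rule emeasure_measure_of[OF sum_measure_def])
  show "sets M \<subseteq> Pow (space M)" by (rule sets.space_closed)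
  show "A \<in> sets (sum_measure M N)" using assms by simp
  show "positive (sets (sum_measure M N)) (\<lambda>A. emeasure M A + emeasure N A)"
    by (simp add: positive_def)
  show "countably_additive (sets (sum_measure M N)) (\<lambda>A. emeasure M A + emeasure N A)"
  proof (rule countably_additiveI)
    fix B :: "nat \<Rightarrow> 'a set"
    assume B: "range B \<subseteq> sets (sum_measure M N)" "disjoint_family B"
    then have "(\<Sum>i. emeasure M (B i) + emeasure N (B i)) = (\<Sum>i. emeasure M (B i)) + (\<Sum>i. emeasure N (B i))"
      by (intro suminf_add[symmetric]) auto
    also have "\<dots> = emeasure M (\<Union>(range B)) + emeasure N (\<Union>(range B))"
      using B assms by (simp add: suminf_emeasure)
    finally show "(\<Sum>i. emeasure M (B i) + emeasure N (B i)) =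
      emeasure M (\<Union>(range B)) + emeasure N (\<Union>(range B))" .
  qed
qed

lemma integral_sum_measure_ge:
  fixes f :: "'a \<Rightarrow> real"
  assumes s: "sets N = sets M" and f: "integrable (sum_measure M N) f" "\<And>x. 0 \<le> f x"
  shows "(\<integral>x. f x \<partial>M) \<le> (\<integral>x. f x \<partial>sum_measure M N)"
    and "(\<integral>x. f x \<partial>N) \<le> (\<integral>x. f x \<partial>sum_measure M N)"
proof -
  let ?S = "sum_measure M N"
  have fin: "(\<integral>\<^sup>+x. f x \<partial>?S) = ennreal (\<integral>x. f x \<partial>?S)"
    using f by (intro nn_integral_eq_integral) auto
  have le: "(\<integral>x. f x \<partial>K) \<le> (\<integral>x. f x \<partial>?S)"
    if K: "sets K = sets M" "\<And>A. A \<in> sets M \<Longrightarrow> emeasure K A \<le> emeasure ?S A" for K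
  proof -
    have "K \<le> ?S"
      using K by (subst le_measure) (auto simp: le_fun_def emeasure_notin_sets)
    then have "(\<integral>\<^sup>+x. f x \<partial>K) \<le> (\<integral>\<^sup>+x. f x \<partial>?S)"
      using K by (intro nn_integral_mono_measure) auto
    moreover have "f \<in> borel_measurable K"
      using f(1) K(1) by (simp add: borel_measurable_integrable measurable_cong_sets[of K ?S])
    ultimately show ?thesis
      using f(2) by (subst integral_eq_nn_integral) (auto simp: fin intro!: enn2real_leI integral_nonneg_AE)
  qed
  show "(\<integral>x. f x \<partial>M) \<le> (\<integral>x. f x \<partial>?S)" "(\<integral>x. f x \<partial>N) \<le> (\<integral>x. f x \<partial>?S)"
    by (rule le; simp add: s emeasure_sum_measure)+
qed

text \<open>
  Regularity of finite Borel measures squeezes the set between a compact \<open>K\<close> and an open \<open>U\<close>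
  of nearly equal measure. An Urysohn function for this pair differs from the indicator only on
  \<open>U - K\<close>.
\<close>

lemma continuous_approx_indicator:
  fixes M :: "'a::euclidean_space measure"
  assumes "finite_measure M" and sM: "sets M = sets borel" and A: "A \<in> sets M" and "e > 0"
  shows "\<exists>g::'a \<Rightarrow> real. continuous_on UNIV g \<and> (\<forall>x. 0 \<le> g x \<and> g x \<le> 1) \<and>
    (\<integral>x. \<bar>indicator A x - g x\<bar> \<partial>M) < e"
proof -
  interpret finite_measure M by fact
  have A': "A \<in> sets borel" using A sM by simp
  have e2: "ennreal (e/2) > 0" using \<open>e > 0\<close> by simp
  have "emeasure M A < emeasure M A + ennreal (e/2)"
    using e2 emeasure_finite[of A] by (simp add: emeasure_eq_measure ennreal_plus[symmetric] ennreal_lessI \<open>e > 0\<close> del: ennreal_plus)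
  then have "(INF U \<in> {U. A \<subseteq> U \<and> open U}. emeasure M U) < emeasure M A + ennreal (e/2)"
    by (subst outer_regular[OF sM _ A', symmetric]) auto
  then obtain U where U: "A \<subseteq> U" "open U" "emeasure M U < emeasure M A + ennreal (e/2)"
    by (auto simp: INF_less_iff)
  have inner: "emeasure M A = (SUP K \<in> {K. K \<subseteq> A \<and> compact K}. emeasure M K)"
    by (rule inner_regular[OF sM _ A']) auto
  have "\<exists>K. K \<subseteq> A \<and> compact K \<and> emeasure M A < emeasure M K + ennreal (e/2)"
  proof (rule ccontr)
    assume "\<not> ?thesis"
    then have *: "emeasure M K + ennreal (e/2) \<le> emeasure M A" if "K \<subseteq> A" "compact K" for K
      using that by (meson not_le)
    then have "measure M K \<le> measure M A - e/2" if "K \<subseteq> A" "compact K" for K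
      using *[OF that] \<open>e > 0\<close> by (simp add: emeasure_eq_measure ennreal_plus[symmetric] del: ennreal_plus)
    then have "emeasure M K \<le> ennreal (measure M A - e/2)" if "K \<subseteq> A" "compact K" for K
      using that by (simp add: emeasure_eq_measure ennreal_leI)
    then have "emeasure M A \<le> ennreal (measure M A - e/2)"
      by (subst inner) (auto intro!: SUP_least)
    moreover have "0 \<le> measure M A - e/2"
      using *[of "{}"] \<open>e > 0\<close> by (simp add: emeasure_eq_measure)
    ultimately show False using \<open>e > 0\<close> by (simp add: emeasure_eq_measure)
  qed
  then obtain K where K: "K \<subseteq> A" "compact K" "emeasure M A < emeasure M K + ennreal (e/2)" by auto
  have [measurable]: "U \<in> sets M" "K \<in> sets M" "A \<in> sets M" using U K sM A by (auto intro: borel_closed compact_imp_closed)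
  have mU: "measure M U < measure M A + e/2"
    using U(3) \<open>e > 0\<close> by (simp add: emeasure_eq_measure ennreal_plus[symmetric] ennreal_less_iff del: ennreal_plus)
  have mK: "measure M A < measure M K + e/2"
    using K(3) \<open>e > 0\<close> by (simp add: emeasure_eq_measure ennreal_plus[symmetric] ennreal_less_iff del: ennreal_plus)
  have "closed (- U)" "closed K" "- U \<inter> K = {}" using U K by (auto simp: compact_imp_closed)
  then have "\<exists>g :: 'a \<Rightarrow> real. continuous_on UNIV g \<and> (\<forall>x. g x \<in> closed_segment 0 1) \<and>
      (\<forall>x\<in>-U. g x = 0) \<and> (\<forall>x\<in>K. g x = 1)"
    by (rule Urysohn[of "-U" K "0::real" 1]) blast
  then obtain g :: "'a \<Rightarrow> real" where g: "continuous_on UNIV g" "\<And>x. g x \<in> closed_segment 0 1"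
    "\<And>x. x \<in> -U \<Longrightarrow> g x = 0" "\<And>x. x \<in> K \<Longrightarrow> g x = 1"
    by blast
  have g01: "0 \<le> g x" "g x \<le> 1" for x using g(2)[of x] by (auto simp: closed_segment_eq_real_ivl)
  have [measurable]: "g \<in> borel_measurable M"
    using borel_measurable_continuous_onI[OF g(1)] by (simp add: measurable_cong_sets[OF sM refl])
  have "(\<integral>x. \<bar>indicator A x - g x\<bar> \<partial>M) \<le> (\<integral>x. indicator (U - K) x \<partial>M)"
  proof (rule integral_mono)
    show "integrable M (\<lambda>x. \<bar>indicator A x - g x\<bar>)"
    proof (rule integrable_const_bound[where B=1])
      have "\<bar>indicator A x - g x\<bar> \<le> 1" for x using g01[of x] by (auto simp: indicator_def)
      then show "AE x in M. norm \<bar>indicator A x - g x\<bar> \<le> 1" by simp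
    qed simp
    show "integrable M (indicator (U - K) :: 'a \<Rightarrow> real)" by (intro integrable_real_indicator) (auto simp: less_top[symmetric])
    show "\<bar>indicator A x - g x\<bar> \<le> indicator (U - K) x" for x
      using U(1) K(1) g(3,4)[of x] g01[of x] by (auto simp: indicator_def)
  qed
  also have "\<dots> = measure M U - measure M K" using U(1) K(1) 
    by (auto simp: measure_Diff subset_trans)
  also have "\<dots> < e" using mU mK by simp
  finally show ?thesis using g(1) g01 by blast
qed

lemma continuous_dense_L1:
  fixes M :: "'a::euclidean_space measure" and f :: "'a \<Rightarrow> real"
  assumes "finite_measure M" and sM: "sets M = sets borel" and f: "integrable M f"
  shows "e > 0 \<Longrightarrow> \<exists>g. continuous_on UNIV g \<and> integrable M g \<and> (\<integral>x. \<bar>f x - g x\<bar> \<partial>M) < e"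
  using f
proof (induction f arbitrary: e rule: integrable_induct)
  case (base A c)
  interpret finite_measure M by fact
  have "e / (\<bar>c\<bar> + 1) > 0" using base by simp
  from continuous_approx_indicator[OF assms(1,2) base(1) this]
  obtain g where g: "continuous_on UNIV g" "\<And>x. 0 \<le> g x \<and> g x \<le> 1"
    "(\<integral>x. \<bar>indicator A x - g x\<bar> \<partial>M) < e / (\<bar>c\<bar> + 1)" by blast
  have [measurable]: "g \<in> borel_measurable M"
    using borel_measurable_continuous_onI[OF g(1)] by (simp add: measurable_cong_sets[OF sM refl])
  have "integrable M g" by (rule integrable_const_bound[where B=1]) (use g(2) in auto)
  moreover have "(\<integral>x. \<bar>indicator A x *\<^sub>R c - c * g x\<bar> \<partial>M) = (\<integral>x. \<bar>c\<bar> * \<bar>indicator A x - g x\<bar> \<partial>M)"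
    by (intro Bochner_Integration.integral_cong refl) (simp add: abs_mult[symmetric] algebra_simps)
  moreover have "\<dots> \<le> (\<bar>c\<bar> + 1) * (\<integral>x. \<bar>indicator A x - g x\<bar> \<partial>M)"
    by (simp add: mult_right_mono)
  moreover have "\<dots> < e" using g(3) by (simp add: field_simps)
  ultimately show ?case using g(1) by (intro exI[of _ "\<lambda>x. c * g x"]) (auto intro!: continuous_intros)
next
  case (add f1 f2)
  obtain g1 where g1: "continuous_on UNIV g1" "integrable M g1" "(\<integral>x. \<bar>f1 x - g1 x\<bar> \<partial>M) < e/2"
    using add.IH(1)[of "e/2"] add.prems by auto
  obtain g2 where g2: "continuous_on UNIV g2" "integrable M g2" "(\<integral>x. \<bar>f2 x - g2 x\<bar> \<partial>M) < e/2"
    using add.IH(2)[of "e/2"] add.prems by auto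
  have "(\<integral>x. \<bar>(f1 x + f2 x) - (g1 x + g2 x)\<bar> \<partial>M) \<le> (\<integral>x. \<bar>f1 x - g1 x\<bar> + \<bar>f2 x - g2 x\<bar> \<partial>M)"
    using add.hyps g1 g2 by (intro integral_mono) auto
  also have "\<dots> = (\<integral>x. \<bar>f1 x - g1 x\<bar> \<partial>M) + (\<integral>x. \<bar>f2 x - g2 x\<bar> \<partial>M)"
    using add.hyps g1 g2 by (intro Bochner_Integration.integral_add) auto
  also have "\<dots> < e" using g1 g2 by simp
  finally show ?case using g1 g2 by (intro exI[of _ "\<lambda>x. g1 x + g2 x"]) (auto intro!: continuous_intros)
next
  case (lim f s)
  have "(\<lambda>i. \<integral>x. \<bar>f x - s i x\<bar> \<partial>M) \<longlonglongrightarrow> (\<integral>x. 0 \<partial>M)"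
  proof (rule integral_dominated_convergence[where w="\<lambda>x. 3 * norm (f x)"])
    show "AE x in M. (\<lambda>i. \<bar>f x - s i x\<bar>) \<longlonglongrightarrow> 0"
    proof (rule AE_I2)
      fix x assume "x \<in> space M"
      from tendsto_diff[OF tendsto_const[of "f x"] lim.hyps(2)[OF this]]
      show "(\<lambda>i. \<bar>f x - s i x\<bar>) \<longlonglongrightarrow> 0" by (simp add: tendsto_rabs_zero_iff)
    qed
    show "AE x in M. norm (\<bar>f x - s i x\<bar>) \<le> 3 * norm (f x)" for i
      by (rule AE_I2) (use lim.hyps(3)[of _ i] in \<open>fastforce\<close>)
  qed (use lim.hyps in auto)
  then have "eventually (\<lambda>i. (\<integral>x. \<bar>f x - s i x\<bar> \<partial>M) < e/2) sequentially"
    using lim.prems by (intro order_tendstoD) auto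
  then obtain i where i: "(\<integral>x. \<bar>f x - s i x\<bar> \<partial>M) < e/2" by (auto simp: eventually_sequentially)
  obtain g where g: "continuous_on UNIV g" "integrable M g" "(\<integral>x. \<bar>s i x - g x\<bar> \<partial>M) < e/2"
    using lim.IH[of "e/2" i] lim.prems by auto
  have "(\<integral>x. \<bar>f x - g x\<bar> \<partial>M) \<le> (\<integral>x. \<bar>f x - s i x\<bar> + \<bar>s i x - g x\<bar> \<partial>M)"
    using lim.hyps g by (intro integral_mono) auto
  also have "\<dots> = (\<integral>x. \<bar>f x - s i x\<bar> \<partial>M) + (\<integral>x. \<bar>s i x - g x\<bar> \<partial>M)"
    using lim.hyps g by (intro Bochner_Integration.integral_add) auto
  also have "\<dots> < e" using i g by simp
  finally show ?case using g by blast
qed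

section \<open>Real parts of polynomials on the unit circle\<close>

lemma re_poly_sum:
  assumes "finite I" "\<And>i. i \<in> I \<Longrightarrow> \<exists>h. \<forall>z::complex. cmod z = 1 \<longrightarrow> f i z = Re (poly h z)"
  shows "\<exists>h. \<forall>z. cmod z = 1 \<longrightarrow> (\<Sum>i\<in>I. f i z) = Re (poly h z)"
proof -
  obtain h where "\<And>i z. i \<in> I \<Longrightarrow> cmod z = 1 \<Longrightarrow> f i z = Re (poly (h i) z)"
    using assms(2) by metis
  then show ?thesis
    by (intro exI[of _ "\<Sum>i\<in>I. h i"]) (simp add: poly_sum)
qed

text \<open>
  On the unit circle conjugation is inversion, so powers of \<open>z\<close> and of \<open>cnj z\<close> cancel. If
  \<open>cnj z\<close> has the larger exponent, a conjugation that leaves the real part unchanged turns the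
  remaining power into a power of \<open>z\<close>.
\<close>

lemma re_monomial_cnj:
  "\<exists>h. \<forall>z::complex. cmod z = 1 \<longrightarrow> Re (c * z ^ j * cnj (z ^ k)) = Re (poly h z)"
proof (cases "k \<le> j")
  case True
  have "c * z ^ j * cnj (z ^ k) = poly (monom c (j - k)) z" if "cmod z = 1" for z
  proof -
    have "z ^ j = z ^ (j - k) * z ^ k" using True by (simp flip: power_add)
    moreover have "z ^ k * cnj (z ^ k) = 1" using that
      by (metis complex_norm_square norm_power of_real_1 power_one)
    ultimately show ?thesis by (simp add: poly_monom mult.assoc)
  qed
  then show ?thesis by metis
next
  case False
  have "Re (c * z ^ j * cnj (z ^ k)) = Re (poly (monom (cnj c) (k - j)) z)" if "cmod z = 1" for z
  proof -
    have "z ^ k = z ^ (k - j) * z ^ j" using False by (simp flip: power_add)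
    moreover have "z ^ j * cnj (z ^ j) = 1" using that
      by (metis complex_norm_square norm_power of_real_1 power_one)
    ultimately have "c * z ^ j * cnj (z ^ k) = c * cnj (z ^ (k - j))"
      by (simp add: mult.assoc mult.left_commute)
    also have "\<dots> = cnj (poly (monom (cnj c) (k - j)) z)" by (simp add: poly_monom)
    finally show ?thesis by simp
  qed
  then show ?thesis by metis
qed

text \<open>
  \<open>Re u Re v\<close> is the mean of \<open>Re (u v)\<close> and \<open>Re (u cnj v)\<close>; the first comes from the product
  polynomial, the second is a sum of monomials in \<open>z\<close> and \<open>cnj z\<close>.
\<close>

lemma re_poly_mult:
  "\<exists>h. \<forall>z::complex. cmod z = 1 \<longrightarrow> Re (poly a z) * Re (poly b z) = Re (poly h z)"
proof -
  have "\<exists>h. \<forall>z. cmod z = 1 \<longrightarrow> (\<Sum>j\<le>degree a. \<Sum>k\<le>degree b.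
      Re (coeff a j * cnj (coeff b k) * z ^ j * cnj (z ^ k))) = Re (poly h z)"
    by (intro re_poly_sum re_monomial_cnj finite_atMost)
  then obtain h where h: "\<And>z. cmod z = 1 \<Longrightarrow> (\<Sum>j\<le>degree a. \<Sum>k\<le>degree b.
      Re (coeff a j * cnj (coeff b k) * z ^ j * cnj (z ^ k))) = Re (poly h z)" by blast
  have "poly a z * cnj (poly b z) = (\<Sum>j\<le>degree a. \<Sum>k\<le>degree b.
      coeff a j * cnj (coeff b k) * z ^ j * cnj (z ^ k))" for z
    unfolding poly_altdef cnj_sum sum_product by (intro sum.cong refl) (simp add: ac_simps)
  then have cj: "Re (poly a z * cnj (poly b z)) = Re (poly h z)" if "cmod z = 1" for z
    using h[OF that] by simp
  have "Re u * Re v = (Re (u * v) + Re (u * cnj v)) / 2" for u v by simp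
  then have "Re (poly a z) * Re (poly b z) = Re (poly (smult (1/2) (a * b + h)) z)"
    if "cmod z = 1" for z using cj[OF that] by simp
  then show ?thesis by blast
qed

text \<open>
  The coordinate functions are real parts of \<open>z\<close> and \<open>- \<i> z\<close>, and real parts of polynomials
  form an algebra on the circle. With the Stone-Weierstrass theorem this makes real parts of
  polynomials uniformly dense in the continuous functions.
\<close>

lemma real_polynomial_function_on_circle:
  assumes "real_polynomial_function (f :: complex \<Rightarrow> real)"
  shows "\<exists>h. \<forall>z. cmod z = 1 \<longrightarrow> f z = Re (poly h z)"
  using assms
proof induction
  case (linear f)
  then interpret bounded_linear f .
  have "f z = Re (poly [:0, Complex (f 1) (- f \<i>):] z)" for z
  proof -
    have "z = Re z *\<^sub>R 1 + Im z *\<^sub>R \<i>" by (simp add: complex_eq_iff)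
    then have "f z = f (Re z *\<^sub>R 1 + Im z *\<^sub>R \<i>)" by (rule arg_cong)
    also have "\<dots> = Re z * f 1 + Im z * f \<i>" by (simp add: add scaleR)
    finally show ?thesis by (simp add: algebra_simps)
  qed
  then show ?case by blast
next
  case (const c)
  show ?case by (intro exI[of _ "[:of_real c:]"]) simp
next
  case (add f g)
  then obtain a b where "\<And>z. cmod z = 1 \<Longrightarrow> f z = Re (poly a z)" "\<And>z. cmod z = 1 \<Longrightarrow> g z = Re (poly b z)"
    by blast
  then show ?case by (intro exI[of _ "a + b"]) simp
next
  case (mult f g)
  then obtain a b where "\<And>z. cmod z = 1 \<Longrightarrow> f z = Re (poly a z)" "\<And>z. cmod z = 1 \<Longrightarrow> g z = Re (poly b z)"
    by blast
  then show ?case using re_poly_mult[of a b] by simp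
qed

lemma re_poly_dense_on_circle:
  fixes f :: "complex \<Rightarrow> real"
  assumes "continuous_on (sphere 0 1) f" "e > 0"
  shows "\<exists>h. \<forall>z. cmod z = 1 \<longrightarrow> \<bar>f z - Re (poly h z)\<bar> < e"
proof -
  obtain g where g: "real_polynomial_function g" "\<And>x. x \<in> sphere 0 1 \<Longrightarrow> \<bar>f x - g x\<bar> < e"
    using Stone_Weierstrass_real_polynomial_function[OF compact_sphere assms] by blast
  obtain h where "\<And>z. cmod z = 1 \<Longrightarrow> g z = Re (poly h z)"
    using real_polynomial_function_on_circle[OF g(1)] by blast
  then show ?thesis using g(2) by (intro exI[of _ h]) auto
qed

lemma borel_measurable_circle_iff:
  assumes "radon_measure_circle \<nu>"
  shows "f \<in> measurable \<nu> N \<longleftrightarrow> f \<in> measurable (restrict_space borel {0..<2 * pi}) N"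
  using assms unfolding radon_measure_circle_def by (metis measurable_cong_sets)

lemma space_circle: "radon_measure_circle \<nu> \<Longrightarrow> space \<nu> = {0..<2 * pi}"
  unfolding radon_measure_circle_def by (metis sets_eq_imp_space_eq space_restrict_space2 space_borel space_restrict_space Int_UNIV_right)

lemma borel_measurable_circleI:
  assumes "radon_measure_circle \<nu>" "f \<in> borel_measurable borel"
  shows "f \<in> borel_measurable \<nu>"
  unfolding borel_measurable_circle_iff[OF assms(1)]
  by (rule measurable_restrict_space1) fact

lemma borel_measurable_poly_cis:
  assumes "radon_measure_circle \<nu>"
  shows "(\<lambda>\<theta>. poly h (cis \<theta>)) \<in> borel_measurable \<nu>"
  by (intro borel_measurable_circleI[OF assms] borel_measurable_continuous_onI continuous_intros)

text \<open>
  The fundamental domain \<open>[0, 2\<pi>)\<close> hides continuity across the point \<open>0\<close> of the circle, so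
  functions are moved to the plane, where continuity on the circle is the usual one. The transport
  uses a Borel section of \<open>cis\<close>; it is written with \<open>arccos\<close> to make its measurability evident.
\<close>

lemma circle_function_on_plane:
  assumes \<nu>: "radon_measure_circle \<nu>" and g: "g \<in> borel_measurable \<nu>" 
  shows "\<exists>G :: complex \<Rightarrow> real. G \<in> borel_measurable borel \<and>
     (\<forall>\<theta>\<in>{0..<2 * pi}. G (cis \<theta>) = g \<theta>) \<and> range G \<subseteq> insert 0 (g ` {0..<2*pi})"
proof -
  \<comment> \<open>truncating \<open>Re z\<close> makes \<open>c\<close> continuous on the whole plane and changes nothing on the circle\<close>
  define c where "c z = arccos (max (-1) (min 1 (Re z)))" for z
  define t where "t z = (if Im z \<ge> 0 then c z else 2 * pi - c z)" for z
  have "continuous_on UNIV c"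
    unfolding c_def by (intro continuous_intros) auto
  then have [measurable]: "c \<in> borel_measurable borel" by (rule borel_measurable_continuous_onI)
  have [measurable]: "Re \<in> borel_measurable borel" "Im \<in> borel_measurable borel"
    by (intro borel_measurable_continuous_onI continuous_intros)+
  have [measurable]: "t \<in> borel_measurable borel" unfolding t_def by measurable
  have t: "t (cis \<theta>) = \<theta>" if "\<theta> \<in> {0..<2 * pi}" for \<theta>
  proof (cases "\<theta> \<le> pi")
    case True
    then show ?thesis using that sin_ge_zero[of \<theta>] by (simp add: t_def c_def arccos_cos)
  next
    case False
    have "sin \<theta> < 0" using False that by (intro sin_lt_zero) auto
    moreover have "arccos (cos \<theta>) = 2 * pi - \<theta>"
      using arccos_cos[of "2 * pi - \<theta>"] False that by (simp add: cos_diff)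
    ultimately show ?thesis by (simp add: t_def c_def)
  qed
  \<comment> \<open>off the circle \<open>t\<close> can take the value \<open>2\<pi>\<close>, outside the domain of \<open>g\<close>\<close>
  define g' where "g' \<theta> = (if \<theta> \<in> {0..<2*pi} then g \<theta> else 0)" for \<theta>
  have "g \<in> borel_measurable (restrict_space borel {0..<2 * pi})"
    using g by (simp only: borel_measurable_circle_iff[OF \<nu>])
  then have [measurable]: "g' \<in> borel_measurable borel"
    unfolding g'_def by (subst (asm) measurable_restrict_space_iff[of _ _ 0]) auto
  have "(\<lambda>z. g' (t z)) \<in> borel_measurable borel" by measurable
  then show ?thesis using t by (intro exI[of _ "\<lambda>z. g' (t z)"]) (auto simp: g'_def)
qed

text \<open>
  A continuous \<open>L\<^sup>1\<close>-approximation is first truncated to \<open>[-M, M]\<close>, which brings it closer to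
  \<open>g\<close>, and only then approximated uniformly. The resulting uniform bound is what allows
  exponentials of the approximations to be integrated.
\<close>

lemma re_poly_dense_L1_circle:
  assumes \<nu>: "radon_measure_circle \<nu>" and g: "g \<in> borel_measurable \<nu>"
    and M: "\<And>\<theta>. \<bar>g \<theta>\<bar> \<le> M" and e: "e > 0"
  shows "\<exists>h. (\<forall>\<theta>. \<bar>Re (poly h (cis \<theta>))\<bar> \<le> M + 1) \<and> (\<integral>\<theta>. \<bar>g \<theta> - Re (poly h (cis \<theta>))\<bar> \<partial>\<nu>) < e"
proof -
  interpret finite_measure \<nu> using \<nu> by (simp add: radon_measure_circle_def)
  have M0: "0 \<le> M" using M[of 0] by linarith
  obtain G :: "complex \<Rightarrow> real" where G[measurable]: "G \<in> borel_measurable borel" and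
     Gg: "\<And>\<theta>. \<theta> \<in> space \<nu> \<Longrightarrow> G (cis \<theta>) = g \<theta>" and Gr: "range G \<subseteq> insert 0 (g ` {0..<2*pi})"
    using circle_function_on_plane[OF \<nu> g] space_circle[OF \<nu>] by auto
  have GM: "\<bar>G z\<bar> \<le> M" for z
  proof -
    have "G z \<in> insert 0 (g ` {0..<2*pi})" using Gr by blast
    then show ?thesis using M M0 by auto
  qed
  define N where "N = distr \<nu> borel cis"
  have cis[measurable]: "cis \<in> borel_measurable \<nu>"
    using borel_measurable_poly_cis[OF \<nu>, of "[:0,1:]"] by simp
  interpret N: finite_measure N unfolding N_def by (intro finite_measure_distr) simp
  have "integrable N G" by (rule N.integrable_const_bound[where B=M]) (simp_all add: GM N_def)
  moreover have "sets N = sets borel" by (simp add: N_def)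
  ultimately obtain G1 where G1: "continuous_on UNIV G1" "integrable N G1" "(\<integral>z. \<bar>G z - G1 z\<bar> \<partial>N) < e/2"
    using continuous_dense_L1[of N G "e/2"] N.finite_measure_axioms e by auto
  define G2 where "G2 z = max (-M) (min M (G1 z))" for z
  have G2c: "continuous_on UNIV G2" unfolding G2_def using G1(1) by (intro continuous_intros)
  have G2M: "\<bar>G2 z\<bar> \<le> M" for z using M0 by (auto simp: G2_def)
  have G2d: "\<bar>G z - G2 z\<bar> \<le> \<bar>G z - G1 z\<bar>" for z using GM[of z] by (auto simp: G2_def)
  \<comment> \<open>at most \<open>1\<close> to keep the bound \<open>M + 1\<close>, and small against the total mass\<close>
  define \<delta> where "\<delta> = min 1 (e / (2 * (measure \<nu> (space \<nu>) + 1)))"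
  have "\<delta> > 0" using e by (simp add: \<delta>_def add_nonneg_pos)
  then obtain h where h: "\<And>z. cmod z = 1 \<Longrightarrow> \<bar>G2 z - Re (poly h z)\<bar> < \<delta>"
    using re_poly_dense_on_circle[of G2 \<delta>] continuous_on_subset[OF G2c] by blast
  have bound: "\<bar>Re (poly h (cis \<theta>))\<bar> \<le> M + 1" for \<theta>
  proof -
    have "\<bar>G2 (cis \<theta>) - Re (poly h (cis \<theta>))\<bar> < 1" using h[of "cis \<theta>"] by (simp add: \<delta>_def)
    then show ?thesis using G2M[of "cis \<theta>"] by linarith
  qed
  have [measurable]: "(\<lambda>\<theta>. poly h (cis \<theta>)) \<in> borel_measurable \<nu>" by (rule borel_measurable_poly_cis[OF \<nu>])
  have [measurable]: "G1 \<in> borel_measurable borel" by (rule borel_measurable_continuous_onI[OF G1(1)])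
  have iG1: "integrable \<nu> (\<lambda>\<theta>. G1 (cis \<theta>))" 
    using G1(2) unfolding N_def by (subst (asm) integrable_distr_eq) auto
  have iG: "integrable \<nu> (\<lambda>\<theta>. G (cis \<theta>))" by (rule integrable_const_bound[where B=M]) (simp_all add: GM)
  have ig: "integrable \<nu> g" by (rule integrable_const_bound[where B=M]) (simp_all add: M g)
  have ih: "integrable \<nu> (\<lambda>\<theta>. Re (poly h (cis \<theta>)))" by (rule integrable_const_bound[where B="M+1"]) (simp_all add: bound)
  have "(\<integral>\<theta>. \<bar>g \<theta> - Re (poly h (cis \<theta>))\<bar> \<partial>\<nu>) \<le> (\<integral>\<theta>. \<bar>G (cis \<theta>) - G1 (cis \<theta>)\<bar> + \<delta> \<partial>\<nu>)"
  proof (rule integral_mono)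
    show "\<bar>g \<theta> - Re (poly h (cis \<theta>))\<bar> \<le> \<bar>G (cis \<theta>) - G1 (cis \<theta>)\<bar> + \<delta>" if "\<theta> \<in> space \<nu>" for \<theta>
      using Gg[OF that] h[of "cis \<theta>"] G2d[of "cis \<theta>"] by simp
  qed (use ig ih iG iG1 in auto)
  also have "\<dots> = (\<integral>\<theta>. \<bar>G (cis \<theta>) - G1 (cis \<theta>)\<bar> \<partial>\<nu>) + \<delta> * measure \<nu> (space \<nu>)"
    using iG iG1 by simp
  also have "(\<integral>\<theta>. \<bar>G (cis \<theta>) - G1 (cis \<theta>)\<bar> \<partial>\<nu>) = (\<integral>z. \<bar>G z - G1 z\<bar> \<partial>N)"
    unfolding N_def by (subst integral_distr) auto
  also have "\<delta> * measure \<nu> (space \<nu>) \<le> e / (2 * (measure \<nu> (space \<nu>) + 1)) * (measure \<nu> (space \<nu>) + 1)"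
    using e by (intro mult_mono) (auto simp: \<delta>_def)
  also have "\<dots> = e / 2"
  proof -
    have "e / (2 * p) * p = e / 2" if "p > 0" for p :: real using that by simp
    from this[of "measure \<nu> (space \<nu>) + 1"] show ?thesis by (simp add: add_nonneg_pos)
  qed
  finally show ?thesis using G1(3) bound by (intro exI[of _ h]) auto
qed

lemma re_poly_dense_L1_circle_seq:
  assumes \<mu>: "radon_measure_circle \<mu>" and \<nu>: "radon_measure_circle \<nu>" and g: "g \<in> borel_measurable \<nu>"
    and M: "\<And>\<theta>. \<bar>g \<theta>\<bar> \<le> M"
  shows "\<exists>h :: nat \<Rightarrow> complex poly. (\<forall>n \<theta>. \<bar>Re (poly (h n) (cis \<theta>))\<bar> \<le> M + 1) \<and>
    (\<lambda>n. \<integral>\<theta>. \<bar>g \<theta> - Re (poly (h n) (cis \<theta>))\<bar> \<partial>\<mu>) \<longlonglongrightarrow> 0 \<and>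
    (\<lambda>n. \<integral>\<theta>. \<bar>g \<theta> - Re (poly (h n) (cis \<theta>))\<bar> \<partial>\<nu>) \<longlonglongrightarrow> 0"
proof -
  let ?S = "sum_measure \<mu> \<nu>"
  have s: "sets \<nu> = sets \<mu>" using \<mu> \<nu> by (simp add: radon_measure_circle_def)
  interpret \<mu>: finite_measure \<mu> using \<mu> by (simp add: radon_measure_circle_def)
  interpret \<nu>: finite_measure \<nu> using \<nu> by (simp add: radon_measure_circle_def)
  have S: "radon_measure_circle ?S"
    unfolding radon_measure_circle_def
  proof
    show "finite_measure ?S"
      using \<mu>.emeasure_finite[of "space \<mu>"] \<nu>.emeasure_finite[of "space \<mu>"]
      by (intro finite_measureI) (simp add: emeasure_sum_measure s)
    show "sets ?S = sets (restrict_space borel {0..<2 * pi})" using \<mu> by (simp add: radon_measure_circle_def)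
  qed
  interpret S: finite_measure ?S using S by (simp add: radon_measure_circle_def)
  have gS: "g \<in> borel_measurable ?S" using g s by (simp add: measurable_cong_sets[of \<nu> ?S])
  have "\<exists>h. (\<forall>\<theta>. \<bar>Re (poly h (cis \<theta>))\<bar> \<le> M + 1) \<and>
      (\<integral>\<theta>. \<bar>g \<theta> - Re (poly h (cis \<theta>))\<bar> \<partial>?S) < 1 / real (Suc n)" for n
    by (rule re_poly_dense_L1_circle[OF S gS M]) simp
  then obtain h :: "nat \<Rightarrow> complex poly" where h: "\<And>n \<theta>. \<bar>Re (poly (h n) (cis \<theta>))\<bar> \<le> M + 1"
    "\<And>n. (\<integral>\<theta>. \<bar>g \<theta> - Re (poly (h n) (cis \<theta>))\<bar> \<partial>?S) < 1 / real (Suc n)"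
    by metis
  have int: "integrable ?S (\<lambda>\<theta>. \<bar>g \<theta> - Re (poly (h n) (cis \<theta>))\<bar>)" for n
  proof (rule S.integrable_const_bound[where B="M + (M + 1)"])
    have "\<bar>g x - Re (poly (h n) (cis x))\<bar> \<le> M + (M + 1)" for x using M[of x] h(1)[of n x] by linarith
    then show "AE x in ?S. norm \<bar>g x - Re (poly (h n) (cis x))\<bar> \<le> M + (M + 1)" by simp
  qed (use gS borel_measurable_poly_cis[OF S] in measurable)
  have lim: "(\<lambda>n. \<integral>\<theta>. \<bar>g \<theta> - Re (poly (h n) (cis \<theta>))\<bar> \<partial>K) \<longlonglongrightarrow> 0" if "K = \<mu> \<or> K = \<nu>" for K
  proof (rule tendsto_sandwich[OF _ _ tendsto_const LIMSEQ_inverse_real_of_nat])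
    show "\<forall>\<^sub>F n in sequentially. 0 \<le> (\<integral>\<theta>. \<bar>g \<theta> - Re (poly (h n) (cis \<theta>))\<bar> \<partial>K)" by simp
    show "\<forall>\<^sub>F n in sequentially. (\<integral>\<theta>. \<bar>g \<theta> - Re (poly (h n) (cis \<theta>))\<bar> \<partial>K) \<le> inverse (real (Suc n))"
    proof (intro always_eventually allI)
      fix n
      have "(\<integral>\<theta>. \<bar>g \<theta> - Re (poly (h n) (cis \<theta>))\<bar> \<partial>K) \<le> (\<integral>\<theta>. \<bar>g \<theta> - Re (poly (h n) (cis \<theta>))\<bar> \<partial>?S)"
        using integral_sum_measure_ge[OF s int] that by auto
      then show "(\<integral>\<theta>. \<bar>g \<theta> - Re (poly (h n) (cis \<theta>))\<bar> \<partial>K) \<le> inverse (real (Suc n))"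
        using h(2)[of n] by (simp add: inverse_eq_divide)
    qed
  qed
  show ?thesis using h(1) lim by blast
qed

text \<open>
  On \<open>[-K, K]\<close> the exponential is Lipschitz with constant \<open>exp K\<close>, so under a uniform bound
  it preserves convergence in \<open>L\<^sup>1\<close>.
\<close>

lemma (in finite_measure) integral_exp_L1_limit:
  fixes g :: "'a \<Rightarrow> real"
  assumes [measurable]: "g \<in> borel_measurable M" "\<And>n. u n \<in> borel_measurable M" "f \<in> borel_measurable M"
    and K: "\<And>x. \<bar>g x\<bar> \<le> K" "\<And>n x. \<bar>u n x\<bar> \<le> K" and C: "\<And>x. \<bar>f x\<bar> \<le> C"
    and lim: "(\<lambda>n. \<integral>x. \<bar>g x - u n x\<bar> \<partial>M) \<longlonglongrightarrow> 0"
  shows "(\<lambda>n. \<integral>x. f x * exp (u n x) \<partial>M) \<longlonglongrightarrow> (\<integral>x. f x * exp (g x) \<partial>M)"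
    and "(\<lambda>n. \<integral>x. u n x \<partial>M) \<longlonglongrightarrow> (\<integral>x. g x \<partial>M)"
proof -
  have C0: "0 \<le> C" using C[of undefined] by linarith
  have ib: "integrable M v" if "v \<in> borel_measurable M" "\<And>x. \<bar>v x\<bar> \<le> B" for v :: "'a \<Rightarrow> real" and B
    by (rule integrable_const_bound[where B=B]) (use that in auto)
  have ig: "integrable M g" by (rule ib[OF assms(1) K(1)])
  have iu: "integrable M (u n)" for n by (rule ib[OF assms(2) K(2)])
  have ie: "integrable M (\<lambda>x. f x * exp (v x))" if [measurable]: "v \<in> borel_measurable M" and "\<And>x. \<bar>v x\<bar> \<le> K" for v
  proof (rule ib[where B="C * exp K"])
    show "\<bar>f x * exp (v x)\<bar> \<le> C * exp K" for x
      unfolding abs_mult using C0 C that(2)[of x] by (intro mult_mono) (auto simp: abs_le_iff)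
  qed simp
  have expdiff: "\<bar>exp a - exp b\<bar> \<le> exp K * \<bar>b - a\<bar>" if "\<bar>a\<bar> \<le> K" "\<bar>b\<bar> \<le> K" for a b :: real
  proof -
    have main: "exp x - exp y \<le> exp K * (x - y)" if "y \<le> x" "x \<le> K" for x y :: real
    proof -
      have "exp x - exp y = exp x * (1 - exp (y - x))" by (simp add: algebra_simps flip: exp_add)
      also have "\<dots> \<le> exp x * (x - y)" 
      proof (rule mult_left_mono)
        show "1 - exp (y - x) \<le> x - y" using exp_ge_add_one_self[of "y - x"] by linarith
      qed simp
      also have "\<dots> \<le> exp K * (x - y)" using that by (intro mult_right_mono) auto
      finally show ?thesis .
    qed
    show ?thesis using main[of a b] main[of b a] abs_le_D1[OF that(1)] abs_le_D1[OF that(2)]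
      by (cases "a \<le> b") (simp_all add: abs_if)
  qed
  show "(\<lambda>n. \<integral>x. f x * exp (u n x) \<partial>M) \<longlonglongrightarrow> (\<integral>x. f x * exp (g x) \<partial>M)"
  proof (rule Lim_transform2[OF tendsto_const], rule Lim_null_comparison)
    show "(\<lambda>n. C * exp K * (\<integral>x. \<bar>g x - u n x\<bar> \<partial>M)) \<longlonglongrightarrow> 0" using tendsto_mult_right_zero[OF lim] by simp
    show "\<forall>\<^sub>F n in sequentially. norm ((\<integral>x. f x * exp (g x) \<partial>M) - (\<integral>x. f x * exp (u n x) \<partial>M))
         \<le> C * exp K * (\<integral>x. \<bar>g x - u n x\<bar> \<partial>M)"
    proof (intro always_eventually allI)
      fix n
      have "(\<integral>x. f x * exp (g x) \<partial>M) - (\<integral>x. f x * exp (u n x) \<partial>M) = (\<integral>x. f x * exp (g x) - f x * exp (u n x) \<partial>M)"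
        using ie K by (intro Bochner_Integration.integral_diff[symmetric]) auto
      also have "norm \<dots> \<le> (\<integral>x. norm (f x * exp (g x) - f x * exp (u n x)) \<partial>M)"
        by (rule integral_norm_bound)
      also have "\<dots> \<le> (\<integral>x. C * exp K * \<bar>g x - u n x\<bar> \<partial>M)"
      proof (rule integral_mono)
        show "norm (f x * exp (g x) - f x * exp (u n x)) \<le> C * exp K * \<bar>g x - u n x\<bar>" for x
        proof -
          have "norm (f x * exp (g x) - f x * exp (u n x)) = \<bar>f x\<bar> * \<bar>exp (g x) - exp (u n x)\<bar>"
            by (simp add: abs_mult[symmetric] algebra_simps)
          also have "\<dots> \<le> C * (exp K * \<bar>g x - u n x\<bar>)"
            using expdiff[of "g x" "u n x"] K C0 C by (intro mult_mono) (auto simp: abs_minus_commute)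
          finally show ?thesis by simp
        qed
      qed (use ie[of g] ie[of "u n"] K ig iu in auto)
      finally show "norm ((\<integral>x. f x * exp (g x) \<partial>M) - (\<integral>x. f x * exp (u n x) \<partial>M))
         \<le> C * exp K * (\<integral>x. \<bar>g x - u n x\<bar> \<partial>M)" by simp
    qed
  qed
  show "(\<lambda>n. \<integral>x. u n x \<partial>M) \<longlonglongrightarrow> (\<integral>x. g x \<partial>M)"
  proof (rule Lim_transform2[OF tendsto_const], rule Lim_null_comparison[OF _ lim])
    show "\<forall>\<^sub>F n in sequentially. norm ((\<integral>x. g x \<partial>M) - (\<integral>x. u n x \<partial>M)) \<le> (\<integral>x. \<bar>g x - u n x\<bar> \<partial>M)"
    proof (intro always_eventually allI)
      fix n
      have "(\<integral>x. g x \<partial>M) - (\<integral>x. u n x \<partial>M) = (\<integral>x. g x - u n x \<partial>M)" using ig iu by simp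
      then show "norm ((\<integral>x. g x \<partial>M) - (\<integral>x. u n x \<partial>M)) \<le> (\<integral>x. \<bar>g x - u n x\<bar> \<partial>M)"
        using integral_norm_bound[of M "\<lambda>x. g x - u n x"] by simp
    qed
  qed
qed

section \<open>The two inequalities for bounded weights\<close>

lemma prob_space_haar_circle: "prob_space haar_circle"
  by (rule prob_spaceI) (rule emeasure_haar_circle_space)

lemma integral_haar_circle:
  fixes f :: "real \<Rightarrow> 'b::{banach, second_countable_topology}"
  assumes f: "f \<in> borel_measurable borel"
  shows "integral\<^sup>L haar_circle f = (1 / (2 * pi)) *\<^sub>R (\<integral>\<theta>. indicator {0..<2 * pi} \<theta> *\<^sub>R f \<theta> \<partial>lborel)"
proof -
  have hd: "haar_circle = density (restrict_space lborel {0..<2 * pi}) (\<lambda>_. ennreal (1 / (2 * pi)))"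
  proof (rule measure_eqI)
    show "emeasure haar_circle A = emeasure (density (restrict_space lborel {0..<2 * pi}) (\<lambda>_. ennreal (1 / (2 * pi)))) A"
      if "A \<in> sets haar_circle" for A
      using that unfolding haar_circle_def
      by (subst emeasure_density) (auto simp: nn_integral_cmult_indicator)
  qed (simp add: haar_circle_def)
  have "integral\<^sup>L haar_circle f = (\<integral>\<theta>. (1 / (2 * pi)) *\<^sub>R f \<theta> \<partial>restrict_space lborel {0..<2 * pi})"
    unfolding hd using f by (intro integral_density) (auto intro: measurable_restrict_space1)
  also have "\<dots> = (1 / (2 * pi)) *\<^sub>R (\<integral>\<theta>. f \<theta> \<partial>restrict_space lborel {0..<2 * pi})" by simp
  also have "(\<integral>\<theta>. f \<theta> \<partial>restrict_space lborel {0..<2 * pi}) = (\<integral>\<theta>. indicator {0..<2 * pi} \<theta> *\<^sub>R f \<theta> \<partial>lborel)"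
    by (rule integral_restrict_space) simp
  finally show ?thesis .
qed

lemma integral_haar_circle_cis_power:
  assumes "k > 0"
  shows "(\<integral>\<theta>. cis \<theta> ^ k \<partial>haar_circle) = 0"
proof -
  define F where "F \<theta> = cis (real k * \<theta>) / (\<i> * of_nat k)" for \<theta>
  have cont: "continuous_on A (\<lambda>\<theta>. cis \<theta> ^ k)" for A by (intro continuous_intros)
  have "(\<integral>\<theta>. indicator {0..2 * pi} \<theta> *\<^sub>R cis \<theta> ^ k \<partial>lborel) = F (2 * pi) - F 0"
  proof (rule integral_FTC_Icc)
    show "(F has_vector_derivative cis \<theta> ^ k) (at \<theta> within {0..2*pi})" for \<theta>
    proof -
      have "((\<lambda>\<theta>. exp (\<theta> *\<^sub>R (\<i> * of_nat k)) / (\<i> * of_nat k)) has_vector_derivative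
          exp (\<theta> *\<^sub>R (\<i> * of_nat k)) * (\<i> * of_nat k) / (\<i> * of_nat k)) (at \<theta> within {0..2*pi})"
        by (intro has_vector_derivative_divide exp_scaleR_has_vector_derivative_right)
      moreover have "exp (\<theta> *\<^sub>R (\<i> * of_nat k)) = cis (real k * \<theta>)" for \<theta>
        by (simp add: cis_conv_exp scaleR_conv_of_real mult_ac)
      ultimately show ?thesis unfolding F_def using assms by (simp add: Complex.DeMoivre)
    qed
  qed (use cont in auto)
  also have "F (2 * pi) = F 0"
    using cis_multiple_2pi[of "real k"] by (simp add: F_def mult_ac)
  finally have "(\<integral>\<theta>. indicator {0..2 * pi} \<theta> *\<^sub>R cis \<theta> ^ k \<partial>lborel) = 0" by simp
  moreover have "(\<integral>\<theta>. indicator {0..<2 * pi} \<theta> *\<^sub>R cis \<theta> ^ k \<partial>lborel) = (\<integral>\<theta>. indicator {0..2 * pi} \<theta> *\<^sub>R cis \<theta> ^ k \<partial>lborel)"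
  proof (rule integral_cong_AE)
    have "AE \<theta> in lborel. \<theta> \<noteq> 2 * pi" by (rule AE_lborel_singleton)
    then show "AE \<theta> in lborel. indicator {0..<2 * pi} \<theta> *\<^sub>R cis \<theta> ^ k = indicator {0..2 * pi} \<theta> *\<^sub>R cis \<theta> ^ k"
      by eventually_elim (auto simp: indicator_def)
  qed (use borel_measurable_continuous_onI[OF cont] in measurable)
  ultimately show ?thesis
    by (subst integral_haar_circle) (use borel_measurable_continuous_onI[OF cont] in auto)
qed

lemma poly_bounded_on_circle: "\<exists>K. \<forall>z::complex. cmod z = 1 \<longrightarrow> cmod (poly h z) \<le> K"
proof (intro exI allI impI)
  fix z :: complex assume "cmod z = 1"
  then have "cmod (coeff h i * z ^ i) = cmod (coeff h i)" for i by (simp add: norm_mult norm_power)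
  then show "cmod (poly h z) \<le> (\<Sum>i\<le>degree h. cmod (coeff h i))"
    unfolding poly_altdef by (metis (no_types, lifting) sum_norm_le order_refl)
qed

lemma integrable_poly_cis:
  assumes "radon_measure_circle \<nu>"
  shows "integrable \<nu> (\<lambda>\<theta>. poly h (cis \<theta>))" "integrable \<nu> (\<lambda>\<theta>. (cmod (poly h (cis \<theta>)))\<^sup>2)"
proof -
  interpret finite_measure \<nu> using assms by (simp add: radon_measure_circle_def)
  obtain K where K: "\<And>z. cmod z = 1 \<Longrightarrow> cmod (poly h z) \<le> K" using poly_bounded_on_circle by blast
  note [measurable] = borel_measurable_poly_cis[OF assms]
  show "integrable \<nu> (\<lambda>\<theta>. poly h (cis \<theta>))"
    by (rule integrable_const_bound[where B=K]) (simp_all add: K)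
  show "integrable \<nu> (\<lambda>\<theta>. (cmod (poly h (cis \<theta>)))\<^sup>2)"
    by (rule integrable_const_bound[where B="K\<^sup>2"]) (simp_all add: K power_mono)
qed

lemma integral_haar_circle_poly: "(\<integral>\<theta>. poly h (cis \<theta>) \<partial>haar_circle) = poly h 0"
proof -
  interpret prob_space haar_circle by (rule prob_space_haar_circle)
  have int: "integrable haar_circle (\<lambda>\<theta>. cis \<theta> ^ i)" for i
    using integrable_poly_cis(1)[OF haar_circle_radon, of "monom 1 i"] by (simp add: poly_monom)
  have "(\<integral>\<theta>. poly h (cis \<theta>) \<partial>haar_circle) = (\<Sum>i\<le>degree h. coeff h i * (\<integral>\<theta>. cis \<theta> ^ i \<partial>haar_circle))"
    unfolding poly_altdef by (subst Bochner_Integration.integral_sum) (auto intro!: int)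
  also have "\<dots> = (\<Sum>i\<le>degree h. coeff h i * (if i = 0 then 1 else 0))"
    using integral_haar_circle_cis_power by (intro sum.cong refl) (auto simp: prob_space)
  also have "\<dots> = poly h 0" by (simp add: poly_0_coeff_0 if_distrib[of "\<lambda>x. _ * x"] cong: if_cong)
  finally show ?thesis .
qed

text \<open>
  The value at \<open>0\<close> is the mean over the circle, and a squared mean is at most the mean square.
\<close>

lemma cmod_poly_0_le_L2:
  "(cmod (poly F 0))\<^sup>2 \<le> (\<integral>\<theta>. (cmod (poly F (cis \<theta>)))\<^sup>2 \<partial>haar_circle)"
proof -
  interpret prob_space haar_circle by (rule prob_space_haar_circle)
  note int = integrable_poly_cis[OF haar_circle_radon, of F]
  have "cmod (poly F 0) \<le> expectation (\<lambda>\<theta>. cmod (poly F (cis \<theta>)))"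
    unfolding integral_haar_circle_poly[symmetric] by (rule integral_norm_bound)
  then have "(cmod (poly F 0))\<^sup>2 \<le> (expectation (\<lambda>\<theta>. cmod (poly F (cis \<theta>))))\<^sup>2"
    by (intro power_mono) auto
  also have "\<dots> \<le> expectation (\<lambda>\<theta>. (cmod (poly F (cis \<theta>)))\<^sup>2)"
    using variance_eq[of "\<lambda>\<theta>. cmod (poly F (cis \<theta>))"] variance_positive[of "\<lambda>\<theta>. cmod (poly F (cis \<theta>))"] int
    by simp
  finally show ?thesis .
qed

text \<open>
  The polynomials are obtained by inserting \<open>(h - h(0)) / 2\<close> into the partial sums of the
  exponential series, so they converge to the outer function \<open>exp ((h - h(0)) / 2)\<close>. Subtracting
  \<open>h(0)\<close> beforehand makes the value \<open>1\<close> at \<open>0\<close> exact for every partial sum.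
\<close>

lemma outer_poly_seq:
  "\<exists>Q K. (\<forall>n. poly (Q n) 0 = 1) \<and> (\<forall>n z. cmod z = 1 \<longrightarrow> cmod (poly (Q n) z) \<le> K) \<and>
     (\<forall>z::complex. (\<lambda>n::nat. (cmod (poly (Q n) z))\<^sup>2) \<longlonglongrightarrow> exp (Re (poly h z) - Re (poly h 0)))"
proof -
  define h0 where "h0 = smult (1/2) (h - [:poly h 0:])"
  define Q where "Q n = (\<Sum>k\<le>n. smult (1 / fact k) (h0 ^ k))" for n
  have Qz: "poly (Q n) z = (\<Sum>k\<le>n. poly h0 z ^ k /\<^sub>R fact k)" for n z
    by (simp add: Q_def poly_sum scaleR_conv_of_real divide_inverse)
  have h00: "poly h0 0 = 0" by (simp add: h0_def)
  obtain R where R: "\<And>z. cmod z = 1 \<Longrightarrow> cmod (poly h0 z) \<le> R" using poly_bounded_on_circle by blast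
  have lim: "(\<lambda>n. poly (Q n) z) \<longlonglongrightarrow> exp (poly h0 z)" for z
    unfolding Qz using exp_converges[of "poly h0 z"] by (simp add: sums_def_le)
  show ?thesis
  proof (intro exI[of _ Q] exI[of _ "exp R"] conjI allI impI)
    show "poly (Q n) 0 = 1" for n
      unfolding Qz h00 by (simp add: power_0_left sum.delta if_distrib[of "\<lambda>x. x /\<^sub>R _"] cong: if_cong)
    show "cmod (poly (Q n) z) \<le> exp R" if "cmod z = 1" for n z
    proof -
      have "cmod (poly (Q n) z) \<le> (\<Sum>k\<le>n. cmod (poly h0 z) ^ k /\<^sub>R fact k)"
        unfolding Qz by (rule sum_norm_le) (simp add: norm_power)
      also have "\<dots> \<le> (\<Sum>k. cmod (poly h0 z) ^ k /\<^sub>R fact k)"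
        by (rule sum_le_suminf[OF summable_exp_generic]) auto
      also have "\<dots> = exp (cmod (poly h0 z))" by (simp add: exp_def)
      also have "\<dots> \<le> exp R" using R[OF that] by simp
      finally show ?thesis .
    qed
    fix z
    have "(\<lambda>n. (cmod (poly (Q n) z))\<^sup>2) \<longlonglongrightarrow> (cmod (exp (poly h0 z)))\<^sup>2"
      by (intro tendsto_intros lim)
    also have "(cmod (exp (poly h0 z)))\<^sup>2 = exp (2 * Re (poly h0 z))"
      by (simp add: exp_double)
    also have "2 * Re (poly h0 z) = Re (poly h z) - Re (poly h 0)" by (simp add: h0_def)
    finally show "(\<lambda>n. (cmod (poly (Q n) z))\<^sup>2) \<longlonglongrightarrow> exp (Re (poly h z) - Re (poly h 0))" .
  qed
qed

text \<open>
  The factor \<open>P\<close> is general for the lower bound on \<open>\<integral>|P|\<^sup>2 exp (Re h)\<close>, while \<open>P = 1\<close> shows that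
  the \<open>Q n\<close> themselves nearly attain the upper bound.
\<close>

lemma integral_outer_poly_seq:
  assumes \<nu>: "radon_measure_circle \<nu>"
  shows "\<exists>Q. (\<forall>n. poly (Q n) 0 = 1) \<and> (\<forall>P. (\<lambda>n::nat. \<integral>\<theta>. (cmod (poly (P * Q n) (cis \<theta>)))\<^sup>2 \<partial>\<nu>)
     \<longlonglongrightarrow> exp (- Re (poly h 0)) * (\<integral>\<theta>. (cmod (poly P (cis \<theta>)))\<^sup>2 * exp (Re (poly h (cis \<theta>))) \<partial>\<nu>))"
proof -
  interpret finite_measure \<nu> using \<nu> by (simp add: radon_measure_circle_def)
  note [measurable] = borel_measurable_poly_cis[OF \<nu>]
  obtain Q K where Q0: "\<And>n. poly (Q n) 0 = 1" and QK: "\<And>n z. cmod z = 1 \<Longrightarrow> cmod (poly (Q n) z) \<le> K"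
    and lim: "\<And>z. (\<lambda>n::nat. (cmod (poly (Q n) z))\<^sup>2) \<longlonglongrightarrow> exp (Re (poly h z) - Re (poly h 0))"
    using outer_poly_seq[of h] by blast
  show ?thesis
  proof (intro exI[of _ Q] conjI allI Q0)
    fix P
    obtain C where C: "\<And>z. cmod z = 1 \<Longrightarrow> cmod (poly P z) \<le> C" using poly_bounded_on_circle by blast
    have "(\<lambda>n. \<integral>\<theta>. (cmod (poly (P * Q n) (cis \<theta>)))\<^sup>2 \<partial>\<nu>) \<longlonglongrightarrow>
      (\<integral>\<theta>. (cmod (poly P (cis \<theta>)))\<^sup>2 * exp (Re (poly h (cis \<theta>)) - Re (poly h 0)) \<partial>\<nu>)"
    proof (rule integral_dominated_convergence[where w="\<lambda>_. (C * K)\<^sup>2"])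
      show "AE \<theta> in \<nu>. (\<lambda>n. (cmod (poly (P * Q n) (cis \<theta>)))\<^sup>2) \<longlonglongrightarrow>
          (cmod (poly P (cis \<theta>)))\<^sup>2 * exp (Re (poly h (cis \<theta>)) - Re (poly h 0))"
        by (intro AE_I2) (simp add: norm_mult power_mult_distrib tendsto_mult_left lim)
      have "cmod (poly (P * Q n) (cis \<theta>)) \<le> C * K" for n \<theta>
        using C[of "cis \<theta>"] QK[of "cis \<theta>" n] by (simp add: norm_mult mult_mono' )
      then show "AE \<theta> in \<nu>. norm ((cmod (poly (P * Q n) (cis \<theta>)))\<^sup>2) \<le> (C * K)\<^sup>2" for n
        by (intro AE_I2) (simp add: power_mono del: poly_mult)
    qed simp_all
    also have "(\<integral>\<theta>. (cmod (poly P (cis \<theta>)))\<^sup>2 * exp (Re (poly h (cis \<theta>)) - Re (poly h 0)) \<partial>\<nu>)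
      = (\<integral>\<theta>. exp (- Re (poly h 0)) * ((cmod (poly P (cis \<theta>)))\<^sup>2 * exp (Re (poly h (cis \<theta>)))) \<partial>\<nu>)"
      by (intro Bochner_Integration.integral_cong refl) (simp add: exp_diff exp_minus field_simps)
    finally show "(\<lambda>n. \<integral>\<theta>. (cmod (poly (P * Q n) (cis \<theta>)))\<^sup>2 \<partial>\<nu>) \<longlonglongrightarrow>
       exp (- Re (poly h 0)) * (\<integral>\<theta>. (cmod (poly P (cis \<theta>)))\<^sup>2 * exp (Re (poly h (cis \<theta>))) \<partial>\<nu>)" by simp
  qed
qed

text \<open>
  Up to the factor \<open>exp (Re (h 0))\<close> the integral is the limit of the mean squares of \<open>P Q\<^sub>n\<close>, and
  each \<open>P Q\<^sub>n\<close> is a polynomial with value \<open>1\<close> at \<open>0\<close>.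
\<close>

lemma weighted_L2_lower_bound_poly:
  assumes P: "poly P 0 = 1"
  shows "exp (Re (poly h 0)) \<le> (\<integral>\<theta>. (cmod (poly P (cis \<theta>)))\<^sup>2 * exp (Re (poly h (cis \<theta>))) \<partial>haar_circle)"
    (is "_ \<le> ?I")
proof -
  obtain Q where Q: "\<And>n. poly (Q n) 0 = 1"
    "(\<lambda>n::nat. \<integral>\<theta>. (cmod (poly (P * Q n) (cis \<theta>)))\<^sup>2 \<partial>haar_circle) \<longlonglongrightarrow> exp (- Re (poly h 0)) * ?I"
    using integral_outer_poly_seq[OF haar_circle_radon, of h] by blast
  have "1 \<le> exp (- Re (poly h 0)) * ?I"
  proof (rule LIMSEQ_le_const[OF Q(2)], intro exI allI impI)
    show "1 \<le> (\<integral>\<theta>. (cmod (poly (P * Q n) (cis \<theta>)))\<^sup>2 \<partial>haar_circle)" for n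
      using cmod_poly_0_le_L2[of "P * Q n"] P Q(1) by simp
  qed
  then show ?thesis by (simp add: exp_minus field_simps)
qed

text \<open>
  The general case follows from \<open>g = Re h\<close>, where \<open>Re (h 0)\<close> is the mean of \<open>g\<close>, by
  approximation in \<open>L\<^sup>1\<close> of Haar measure.
\<close>

lemma weighted_L2_lower_bound:
  assumes g: "g \<in> borel_measurable haar_circle" and M: "\<And>\<theta>. \<bar>g \<theta>\<bar> \<le> M" and P: "poly P 0 = 1"
  shows "exp (\<integral>\<theta>. g \<theta> \<partial>haar_circle) \<le> (\<integral>\<theta>. (cmod (poly P (cis \<theta>)))\<^sup>2 * exp (g \<theta>) \<partial>haar_circle)"
proof -
  interpret prob_space haar_circle by (rule prob_space_haar_circle)
  note [measurable] = borel_measurable_poly_cis[OF haar_circle_radon] 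
  obtain h where h: "\<And>n \<theta>. \<bar>Re (poly (h n) (cis \<theta>))\<bar> \<le> M + 1"
    "(\<lambda>n::nat. \<integral>\<theta>. \<bar>g \<theta> - Re (poly (h n) (cis \<theta>))\<bar> \<partial>haar_circle) \<longlonglongrightarrow> 0"
    using re_poly_dense_L1_circle_seq[OF haar_circle_radon haar_circle_radon g M] by blast
  obtain C where C: "\<And>z. cmod z = 1 \<Longrightarrow> cmod (poly P z) \<le> C" using poly_bounded_on_circle by blast
  have M': "\<bar>g \<theta>\<bar> \<le> M + 1" for \<theta> using M[of \<theta>] by simp
  have C': "\<bar>(cmod (poly P (cis \<theta>)))\<^sup>2\<bar> \<le> C\<^sup>2" for \<theta> using C by (simp add: power_mono)
  have lim: "(\<lambda>n. \<integral>\<theta>. (cmod (poly P (cis \<theta>)))\<^sup>2 * exp (Re (poly (h n) (cis \<theta>))) \<partial>haar_circle)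
     \<longlonglongrightarrow> (\<integral>\<theta>. (cmod (poly P (cis \<theta>)))\<^sup>2 * exp (g \<theta>) \<partial>haar_circle)"
    "(\<lambda>n. \<integral>\<theta>. Re (poly (h n) (cis \<theta>)) \<partial>haar_circle) \<longlonglongrightarrow> (\<integral>\<theta>. g \<theta> \<partial>haar_circle)"
    using integral_exp_L1_limit[where f="\<lambda>\<theta>. (cmod (poly P (cis \<theta>)))\<^sup>2", OF g _ _ M' h(1) C' h(2)]
    by simp_all
  have "(\<integral>\<theta>. Re (poly (h n) (cis \<theta>)) \<partial>haar_circle) = Re (poly (h n) 0)" for n
    using integrable_poly_cis(1)[OF haar_circle_radon] by (simp add: integral_haar_circle_poly)
  with lim(2) have "(\<lambda>n. exp (Re (poly (h n) 0))) \<longlonglongrightarrow> exp (\<integral>\<theta>. g \<theta> \<partial>haar_circle)"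
    by (intro tendsto_exp) simp
  from LIMSEQ_le[OF this lim(1)] show ?thesis using weighted_L2_lower_bound_poly[OF P] by blast
qed

text \<open>
  The mean of \<open>g\<close> refers to Haar measure and the integral of \<open>exp g\<close> to \<open>\<mu>\<close>, which is why \<open>g\<close> has
  to be approximated by real parts of polynomials for both measures simultaneously. Once \<open>g\<close> is such a
  real part, the polynomials approximating the outer function are the required competitors.
\<close>

lemma poly_L2_upper_bound:
  assumes \<mu>: "radon_measure_circle \<mu>" and g: "g \<in> borel_measurable haar_circle"
    and M: "\<And>\<theta>. \<bar>g \<theta>\<bar> \<le> M" and e: "e > 0"
  shows "\<exists>P. poly P 0 = 1 \<and> (\<integral>\<theta>. (cmod (poly P (cis \<theta>)))\<^sup>2 \<partial>\<mu>)
     < exp (- (\<integral>\<theta>. g \<theta> \<partial>haar_circle)) * (\<integral>\<theta>. exp (g \<theta>) \<partial>\<mu>) + e"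
proof -
  interpret m: prob_space haar_circle by (rule prob_space_haar_circle)
  interpret \<mu>: finite_measure \<mu> using \<mu> by (simp add: radon_measure_circle_def)
  note [measurable] = borel_measurable_poly_cis[OF haar_circle_radon] borel_measurable_poly_cis[OF \<mu>]
  have g\<mu>: "g \<in> borel_measurable \<mu>"
    using g unfolding borel_measurable_circle_iff[OF \<mu>] borel_measurable_circle_iff[OF haar_circle_radon] .
  obtain h where h: "\<And>n \<theta>. \<bar>Re (poly (h n) (cis \<theta>))\<bar> \<le> M + 1"
    "(\<lambda>n::nat. \<integral>\<theta>. \<bar>g \<theta> - Re (poly (h n) (cis \<theta>))\<bar> \<partial>haar_circle) \<longlonglongrightarrow> 0"
    "(\<lambda>n::nat. \<integral>\<theta>. \<bar>g \<theta> - Re (poly (h n) (cis \<theta>))\<bar> \<partial>\<mu>) \<longlonglongrightarrow> 0"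
    using re_poly_dense_L1_circle_seq[OF haar_circle_radon \<mu> g\<mu> M] by blast
  have M': "\<bar>g \<theta>\<bar> \<le> M + 1" for \<theta> using M[of \<theta>] by simp
  have "(\<lambda>n. \<integral>\<theta>. 1 * exp (Re (poly (h n) (cis \<theta>))) \<partial>\<mu>) \<longlonglongrightarrow> (\<integral>\<theta>. 1 * exp (g \<theta>) \<partial>\<mu>)"
    by (rule \<mu>.integral_exp_L1_limit(1)[OF g\<mu> _ _ M' h(1) _ h(3), of _ 1]) simp_all
  then have lim1: "(\<lambda>n. \<integral>\<theta>. exp (Re (poly (h n) (cis \<theta>))) \<partial>\<mu>) \<longlonglongrightarrow> (\<integral>\<theta>. exp (g \<theta>) \<partial>\<mu>)" by simp
  have "(\<lambda>n. \<integral>\<theta>. Re (poly (h n) (cis \<theta>)) \<partial>haar_circle) \<longlonglongrightarrow> (\<integral>\<theta>. g \<theta> \<partial>haar_circle)"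
    by (rule m.integral_exp_L1_limit(2)[OF g _ _ M' h(1) _ h(2), of "\<lambda>_. 1" 1]) simp_all
  moreover have "(\<integral>\<theta>. Re (poly (h n) (cis \<theta>)) \<partial>haar_circle) = Re (poly (h n) 0)" for n
    using integrable_poly_cis(1)[OF haar_circle_radon] by (simp add: integral_haar_circle_poly)
  ultimately have "(\<lambda>n. exp (- Re (poly (h n) 0))) \<longlonglongrightarrow> exp (- (\<integral>\<theta>. g \<theta> \<partial>haar_circle))"
    by (intro tendsto_exp tendsto_minus) simp
  from tendsto_mult[OF this lim1]
  have "eventually (\<lambda>n. exp (- Re (poly (h n) 0)) * (\<integral>\<theta>. exp (Re (poly (h n) (cis \<theta>))) \<partial>\<mu>)
     < exp (- (\<integral>\<theta>. g \<theta> \<partial>haar_circle)) * (\<integral>\<theta>. exp (g \<theta>) \<partial>\<mu>) + e) sequentially"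
    using e by (intro order_tendstoD) auto
  then obtain n where n: "exp (- Re (poly (h n) 0)) * (\<integral>\<theta>. exp (Re (poly (h n) (cis \<theta>))) \<partial>\<mu>)
     < exp (- (\<integral>\<theta>. g \<theta> \<partial>haar_circle)) * (\<integral>\<theta>. exp (g \<theta>) \<partial>\<mu>) + e"
    by (auto simp: eventually_sequentially)
  obtain Q where Q: "\<And>k. poly (Q k) 0 = 1"
    "\<And>P. (\<lambda>k::nat. \<integral>\<theta>. (cmod (poly (P * Q k) (cis \<theta>)))\<^sup>2 \<partial>\<mu>) \<longlonglongrightarrow>
      exp (- Re (poly (h n) 0)) * (\<integral>\<theta>. (cmod (poly P (cis \<theta>)))\<^sup>2 * exp (Re (poly (h n) (cis \<theta>))) \<partial>\<mu>)"
    using integral_outer_poly_seq[OF \<mu>, of "h n"] by blast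
  from Q(2)[of 1] have "(\<lambda>k. \<integral>\<theta>. (cmod (poly (Q k) (cis \<theta>)))\<^sup>2 \<partial>\<mu>) \<longlonglongrightarrow>
      exp (- Re (poly (h n) 0)) * (\<integral>\<theta>. exp (Re (poly (h n) (cis \<theta>))) \<partial>\<mu>)" by simp
  from order_tendstoD(2)[OF this n] obtain k where
    "(\<integral>\<theta>. (cmod (poly (Q k) (cis \<theta>)))\<^sup>2 \<partial>\<mu>) < exp (- (\<integral>\<theta>. g \<theta> \<partial>haar_circle)) * (\<integral>\<theta>. exp (g \<theta>) \<partial>\<mu>) + e"
    by (auto simp: eventually_sequentially)
  then show ?thesis using Q(1) by blast
qed

section \<open>Truncated logarithms\<close>

lemma nn_integral_truncate_tendsto:
  assumes [measurable]: "F \<in> borel_measurable M"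
  shows "(\<lambda>n. \<integral>\<^sup>+x. min (of_nat n) (F x) \<partial>M) \<longlonglongrightarrow> (\<integral>\<^sup>+x. F x \<partial>M)"
proof -
  have lim: "(\<lambda>n. min (of_nat n) (F x)) \<longlonglongrightarrow> F x" for x
  proof -
    have "(\<lambda>n. min (of_nat n) (F x)) \<longlonglongrightarrow> min top (F x)"
      by (intro tendsto_min tendsto_const of_nat_tendsto_top_ennreal)
    then show ?thesis by simp
  qed
  show ?thesis
  proof (rule nn_integral_LIMSEQ[OF _ _ lim])
    show "incseq (\<lambda>n x. min (of_nat n) (F x))"
      by (intro monoI le_funI min.mono) auto
  qed simp
qed

text \<open>
  The logarithm of the density is truncated on both sides, since the inequalities for weights
  \<open>exp g\<close> are available for bounded \<open>g\<close>. The argument of \<open>real_of_ereal\<close> is always finite.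
\<close>

definition clamp_log :: "nat \<Rightarrow> ereal \<Rightarrow> real" where
  "clamp_log n y = real_of_ereal (max (- ereal (real n)) (min (ereal (real n)) y))"

lemma clamp_log_ereal: "ereal (clamp_log n y) = max (- ereal (real n)) (min (ereal (real n)) y)"
  unfolding clamp_log_def by (intro ereal_real') (auto simp: max_def min_def)

lemma abs_clamp_log_le: "\<bar>clamp_log n y\<bar> \<le> real n"
proof -
  have "ereal (clamp_log n y) \<le> ereal (real n)" "ereal (- real n) \<le> ereal (clamp_log n y)"
    unfolding clamp_log_ereal by (auto simp: max_def min_def)
  then show ?thesis by (simp add: abs_le_iff)
qed

lemma clamp_log_real: "clamp_log n (ereal r) = max (- real n) (min (real n) r)"
  by (simp add: clamp_log_def max_def min_def)

text \<open>
  The truncation acts separately on the positive and the negative part, the two parts from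
  which \<open>ext_integral\<close> is built.
\<close>

lemma clamp_log_parts:
  "clamp_log n y = enn2real (min (of_nat n) (e2ennreal y)) - enn2real (min (of_nat n) (e2ennreal (- y)))"
proof -
  have *: "(of_nat n :: ennreal) = ennreal (real n)" by (simp add: ennreal_of_nat_eq_real_of_nat)
  show ?thesis
  proof (cases y)
    case (real r)
    have p: "enn2real (min (ennreal (real n)) (ennreal x)) = max 0 (min (real n) x)" for x
      by (cases "0 \<le> x") (simp_all add: min_def ennreal_neg)
    show ?thesis
      unfolding real clamp_log_real * uminus_ereal.simps e2ennreal_ereal p by (simp add: max_def min_def)
  qed (auto simp: clamp_log_def * e2ennreal_neg e2ennreal_infty)
qed

text \<open>
  Monotone convergence applies to the positive and the negative part; finiteness of the
  former excludes \<open>\<infinity> - \<infinity>\<close>.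
\<close>

lemma clamp_log_integral_tendsto:
  assumes "finite_measure M" and f[measurable]: "f \<in> borel_measurable M"
    and fin: "(\<integral>\<^sup>+x. e2ennreal (f x) \<partial>M) < \<infinity>"
  shows "(\<lambda>n. ereal (\<integral>x. clamp_log n (f x) \<partial>M)) \<longlonglongrightarrow> ext_integral M f"
proof -
  interpret finite_measure M by fact
  have int: "integrable M (\<lambda>x. enn2real (min (of_nat n) (F x)))" 
    and val: "ereal (\<integral>x. enn2real (min (of_nat n) (F x)) \<partial>M) = enn2ereal (\<integral>\<^sup>+x. min (of_nat n) (F x) \<partial>M)"
    if [measurable]: "F \<in> borel_measurable M" for F :: "'a \<Rightarrow> ennreal" and n :: nat
  proof -
    have b: "enn2real (min (of_nat n) (F x)) \<le> real n" for x
      by (intro enn2real_leI) (auto simp: ennreal_of_nat_eq_real_of_nat)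
    show int: "integrable M (\<lambda>x. enn2real (min (of_nat n) (F x)))"
      by (rule integrable_const_bound[where B="real n"]) (use b in auto)
    have "(\<integral>\<^sup>+x. min (of_nat n) (F x) \<partial>M) = (\<integral>\<^sup>+x. ennreal (enn2real (min (of_nat n) (F x))) \<partial>M)"
      by (intro nn_integral_cong ennreal_enn2real[symmetric])
        (auto simp: min_less_iff_disj of_nat_less_top)
    also have "\<dots> = ennreal (\<integral>x. enn2real (min (of_nat n) (F x)) \<partial>M)"
      by (rule nn_integral_eq_integral[OF int]) simp
    finally show "ereal (\<integral>x. enn2real (min (of_nat n) (F x)) \<partial>M) = enn2ereal (\<integral>\<^sup>+x. min (of_nat n) (F x) \<partial>M)"
      by (simp add: integral_nonneg_AE)
  qed
  define a where "a n = (\<integral>\<^sup>+x. min (of_nat n) (e2ennreal (f x)) \<partial>M)" for n :: nat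
  define b where "b n = (\<integral>\<^sup>+x. min (of_nat n) (e2ennreal (- f x)) \<partial>M)" for n :: nat
  have "ereal (\<integral>x. clamp_log n (f x) \<partial>M) = enn2ereal (a n) - enn2ereal (b n)" for n
  proof -
    have "(\<integral>x. clamp_log n (f x) \<partial>M) = (\<integral>x. enn2real (min (of_nat n) (e2ennreal (f x))) \<partial>M)
        - (\<integral>x. enn2real (min (of_nat n) (e2ennreal (- f x))) \<partial>M)"
      unfolding clamp_log_parts by (intro Bochner_Integration.integral_diff int) measurable
    also have "ereal \<dots> = enn2ereal (a n) - enn2ereal (b n)"
      unfolding a_def b_def by (subst (1 2) val[symmetric]) simp_all
    finally show ?thesis .
  qed
  moreover have "(\<lambda>n. enn2ereal (a n) - enn2ereal (b n)) \<longlonglongrightarrow> ext_integral M f"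
    unfolding ext_integral_def a_def b_def
  proof (rule tendsto_diff_ereal_general)
    show "(\<lambda>n. enn2ereal (\<integral>\<^sup>+x. min (of_nat n) (e2ennreal (f x)) \<partial>M)) \<longlonglongrightarrow> enn2ereal (\<integral>\<^sup>+x. e2ennreal (f x) \<partial>M)"
      by (intro tendsto_enn2erealI nn_integral_truncate_tendsto) simp
    show "(\<lambda>n. enn2ereal (\<integral>\<^sup>+x. min (of_nat n) (e2ennreal (- f x)) \<partial>M)) \<longlonglongrightarrow> enn2ereal (\<integral>\<^sup>+x. e2ennreal (- f x) \<partial>M)"
      by (intro tendsto_enn2erealI nn_integral_truncate_tendsto) simp
    show "\<not> (enn2ereal (\<integral>\<^sup>+x. e2ennreal (f x) \<partial>M) = \<infinity> \<and> enn2ereal (\<integral>\<^sup>+x. e2ennreal (- f x) \<partial>M) = \<infinity> \<or>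
      enn2ereal (\<integral>\<^sup>+x. e2ennreal (f x) \<partial>M) = - \<infinity> \<and> enn2ereal (\<integral>\<^sup>+x. e2ennreal (- f x) \<partial>M) = - \<infinity>)"
      using fin by (cases "\<integral>\<^sup>+x. e2ennreal (f x) \<partial>M") auto
  qed
  ultimately show ?thesis by simp
qed

lemma exp_tendsto_ext_exp:
  assumes "(\<lambda>n. ereal (a n)) \<longlonglongrightarrow> I" "I < \<infinity>"
  shows "(\<lambda>n. exp (a n)) \<longlonglongrightarrow> real_of_ereal (ext_exp I)"
proof (cases I)
  case (real r)
  then show ?thesis using assms(1) by (simp add: ext_exp_def tendsto_exp)
next
  case MInf
  then have "filterlim a at_bot sequentially"
    using assms(1) unfolding filterlim_at_bot_dense by (simp add: tendsto_MInfty)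
  then have "((\<lambda>n. exp (a n)) \<longlongrightarrow> 0) sequentially" by (rule filterlim_compose[OF exp_at_bot])
  with MInf show ?thesis by (simp add: ext_exp_def)
qed (use assms in auto)

lemma clamp_log_cases:
  assumes "0 < r"
  shows "clamp_log n (ext_log (ennreal r)) = max (- real n) (min (real n) (ln r))"
  using assms by (simp add: ext_log_def clamp_log_real)

text \<open>
  \<open>exp (clamp_log n (ext_log w))\<close> is \<open>w\<close> truncated to \<open>[exp (-n), exp n]\<close>, and only the lower
  truncation can make it exceed \<open>w\<close>.
\<close>

lemma exp_clamp_log_le: "ennreal (exp (clamp_log n (ext_log w))) \<le> w + ennreal (exp (- real n))"
proof (cases w)
  case (real r)
  show ?thesis
  proof (cases "r = 0")
    case True
    with real show ?thesis by (simp add: clamp_log_def ext_log_def)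
  next
    case False
    with real have r: "r > 0" by simp
    have "exp (max (- real n) (min (real n) (ln r))) \<le> r + exp (- real n)"
    proof (cases "ln r \<le> - real n")
      case True
      then have "max (- real n) (min (real n) (ln r)) = - real n" by simp
      then show ?thesis using r by simp
    next
      case False
      then have "max (- real n) (min (real n) (ln r)) \<le> ln r" by simp
      then have "exp (max (- real n) (min (real n) (ln r))) \<le> r" using r
        by (metis exp_le_cancel_iff exp_ln)
      then show ?thesis by (simp add: add_increasing2)
    qed
    then show ?thesis using r real by (simp add: clamp_log_cases flip: ennreal_plus)
  qed
qed simp

text \<open>
  The quotient of \<open>w\<close> by its truncation exceeds \<open>1\<close> only for \<open>w > exp n\<close>, where it is
  \<open>w exp (-n)\<close>.
\<close>

lemma mult_exp_minus_clamp_log_le: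
  "w * ennreal (exp (- clamp_log n (ext_log w))) \<le> 1 + w * ennreal (exp (- real n))"
proof (cases w)
  case (real r)
  show ?thesis
  proof (cases "r = 0")
    case False
    with real have r: "r > 0" by simp
    have "r * exp (- max (- real n) (min (real n) (ln r))) \<le> 1 + r * exp (- real n)"
    proof (cases "ln r \<le> real n")
      case True
      then have "exp (- max (- real n) (min (real n) (ln r))) \<le> exp (- ln r)" by simp
      also have "\<dots> = 1 / r" using r by (simp add: exp_minus inverse_eq_divide)
      finally have "r * exp (- max (- real n) (min (real n) (ln r))) \<le> 1" using r by (simp add: field_simps)
      then show ?thesis using r by (simp add: add_increasing2)
    next
      case False
      then show ?thesis by simp
    qed
    then have "ennreal (r * exp (- max (- real n) (min (real n) (ln r)))) \<le> ennreal (1 + r * exp (- real n))"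
      by (rule ennreal_leI)
    then show ?thesis using r real by (simp add: clamp_log_cases ennreal_mult ennreal_plus)
  qed (use real in simp)
next
  case top
  then show ?thesis by (simp add: ennreal_top_mult)
qed


section \<open>Szego's theorem\<close>

text \<open>
  If \<open>B\<close> is a Haar null set that carries the singular part, then the absolutely continuous part
  is the restriction of \<open>\<mu>\<close> to the complement of \<open>B\<close>. It is therefore a density with respect to
  both \<open>\<mu>\<close> and Haar measure.
\<close>

lemma ac_part_nn_integral:
  assumes \<mu>: "radon_measure_circle \<mu>"
  shows "\<exists>B\<in>sets haar_circle. emeasure haar_circle B = 0 \<and>
    (\<forall>f\<in>borel_measurable haar_circle.
      (\<integral>\<^sup>+\<theta>. RN_deriv haar_circle (ac_part haar_circle \<mu>) \<theta> * f \<theta> \<partial>haar_circle) =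
      (\<integral>\<^sup>+\<theta>. indicator (space haar_circle - B) \<theta> * f \<theta> \<partial>\<mu>))"
proof -
  interpret m: finite_measure haar_circle using haar_circle_radon by (simp add: radon_measure_circle_def)
  let ?A = "ac_part haar_circle \<mu>"
  have s: "sets \<mu> = sets haar_circle" using \<mu> haar_circle_radon by (simp add: radon_measure_circle_def)
  have sp: "space \<mu> = space haar_circle" using s by (rule sets_eq_imp_space_eq)
  obtain S where dec: "lebesgue_decomposition haar_circle \<mu> ?A S"
    using ac_part_decomposition[OF _ s] \<mu> unfolding radon_measure_circle_def by blast
  then obtain B where B: "B \<in> sets haar_circle" "emeasure haar_circle B = 0"
    "emeasure S (space haar_circle - B) = 0"
    unfolding lebesgue_decomposition_def mutually_singular_def by blast
  have sA: "sets ?A = sets haar_circle" "sets S = sets haar_circle"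
    and ac: "absolutely_continuous haar_circle ?A"
    and add: "\<And>E. E \<in> sets haar_circle \<Longrightarrow> emeasure \<mu> E = emeasure ?A E + emeasure S E"
    using dec unfolding lebesgue_decomposition_def by auto
  have A1: "density haar_circle (RN_deriv haar_circle ?A) = ?A"
    using ac sA by (intro m.density_RN_deriv)
  have ind: "(indicator (space haar_circle - B) :: real \<Rightarrow> ennreal) \<in> borel_measurable \<mu>"
    using B(1) by (intro borel_measurable_indicator) (auto simp: s)
  have A2: "density \<mu> (indicator (space haar_circle - B)) = ?A"
  proof (rule measure_eqI)
    fix E assume "E \<in> sets (density \<mu> (indicator (space haar_circle - B)))"
    then have E: "E \<in> sets haar_circle" by (simp add: s)
    have EB: "E - B \<in> sets haar_circle" using E B(1) by auto
    have "emeasure (density \<mu> (indicator (space haar_circle - B))) E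
        = (\<integral>\<^sup>+\<theta>. indicator (space haar_circle - B) \<theta> * indicator E \<theta> \<partial>\<mu>)"
      using E ind by (subst emeasure_density) (auto simp: s)
    also have "\<dots> = (\<integral>\<^sup>+\<theta>. indicator (E - B) \<theta> \<partial>\<mu>)"
      by (intro nn_integral_cong) (auto simp: sp split: split_indicator)
    also have "\<dots> = emeasure \<mu> (E - B)" using EB by (simp add: s)
    also have "\<dots> = emeasure ?A (E - B)"
    proof -
      have "emeasure S (E - B) \<le> emeasure S (space haar_circle - B)"
        using B(1) sA sets.sets_into_space[OF E] by (intro emeasure_mono) auto
      then show ?thesis using B(3) add[OF EB] by simp
    qed
    also have "\<dots> = emeasure ?A E"
      using ac B E sA unfolding absolutely_continuous_def
      by (intro emeasure_Diff_null_set) (auto simp: null_sets_def)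
    finally show "emeasure (density \<mu> (indicator (space haar_circle - B))) E = emeasure ?A E" .
  qed (simp add: s sA)
  show ?thesis
  proof (intro bexI[of _ B] conjI ballI B(2))
    fix f :: "real \<Rightarrow> ennreal" assume f: "f \<in> borel_measurable haar_circle"
    have f': "f \<in> borel_measurable \<mu>" using f by (simp add: measurable_cong_sets[OF s refl])
    have "(\<integral>\<^sup>+\<theta>. RN_deriv haar_circle ?A \<theta> * f \<theta> \<partial>haar_circle) = (\<integral>\<^sup>+\<theta>. f \<theta> \<partial>?A)"
      using f by (subst (2) A1[symmetric], subst nn_integral_density) auto
    also have "\<dots> = (\<integral>\<^sup>+\<theta>. indicator (space haar_circle - B) \<theta> * f \<theta> \<partial>\<mu>)"
      using f' ind by (subst A2[symmetric], subst nn_integral_density) auto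
    finally show "(\<integral>\<^sup>+\<theta>. RN_deriv haar_circle ?A \<theta> * f \<theta> \<partial>haar_circle) =
      (\<integral>\<^sup>+\<theta>. indicator (space haar_circle - B) \<theta> * f \<theta> \<partial>\<mu>)" .
  qed (rule B(1))
qed

text \<open>
  This is the geometric mean of the density of the absolutely continuous part.
\<close>

definition szego_constant :: "real measure \<Rightarrow> real" where
  "szego_constant \<mu> = real_of_ereal (ext_exp (ext_integral haar_circle
     (\<lambda>\<theta>. ext_log (RN_deriv haar_circle (ac_part haar_circle \<mu>) \<theta>))))"

lemma ext_log_measurable [measurable]: "ext_log \<in> borel_measurable borel"
  unfolding ext_log_def[abs_def] by measurable

lemma clamp_log_measurable [measurable]: "clamp_log n \<in> borel_measurable borel"
  unfolding clamp_log_def[abs_def] by measurable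

lemma exp_clamp_log_integral_tendsto:
  assumes \<mu>: "radon_measure_circle \<mu>"
  shows "(\<lambda>n. exp (\<integral>\<theta>. clamp_log n (ext_log (RN_deriv haar_circle (ac_part haar_circle \<mu>) \<theta>)) \<partial>haar_circle))
    \<longlonglongrightarrow> szego_constant \<mu>"
  unfolding szego_constant_def
proof (rule exp_tendsto_ext_exp[OF clamp_log_integral_tendsto])
  let ?w = "RN_deriv haar_circle (ac_part haar_circle \<mu>)"
  show "finite_measure haar_circle" using haar_circle_radon by (simp add: radon_measure_circle_def)
  interpret \<mu>: finite_measure \<mu> using \<mu> by (simp add: radon_measure_circle_def)
  show "(\<lambda>\<theta>. ext_log (?w \<theta>)) \<in> borel_measurable haar_circle" by measurable
  show "ext_integral haar_circle (\<lambda>\<theta>. ext_log (?w \<theta>)) < \<infinity>"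
    by (rule ext_integral_log_ac_part_less_top[OF \<mu>])
  obtain B where B: "B \<in> sets haar_circle" "\<And>f. f\<in>borel_measurable haar_circle \<Longrightarrow>
      (\<integral>\<^sup>+\<theta>. ?w \<theta> * f \<theta> \<partial>haar_circle) = (\<integral>\<^sup>+\<theta>. indicator (space haar_circle - B) \<theta> * f \<theta> \<partial>\<mu>)"
    using ac_part_nn_integral[OF \<mu>] by blast
  have "(\<integral>\<^sup>+\<theta>. ?w \<theta> \<partial>haar_circle) = (\<integral>\<^sup>+\<theta>. indicator (space haar_circle - B) \<theta> \<partial>\<mu>)"
    using B(2)[of "\<lambda>_. 1"] by simp
  also have "\<dots> \<le> (\<integral>\<^sup>+\<theta>. 1 \<partial>\<mu>)" by (intro nn_integral_mono) (simp split: split_indicator)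
  also have "\<dots> < \<infinity>" using \<mu>.emeasure_finite[of "space \<mu>"] by (simp add: less_top[symmetric])
  finally show "(\<integral>\<^sup>+\<theta>. e2ennreal (ext_log (?w \<theta>)) \<partial>haar_circle) < \<infinity>"
    by (rule ext_integral_log_less_top)
qed

text \<open>
  The weight is the density \<open>w\<close> truncated to \<open>[exp (-n), exp n]\<close>. It exceeds \<open>w\<close> by at most
  \<open>exp (-n)\<close>, and \<open>w\<close> times Haar measure is dominated by \<open>\<mu>\<close>.
\<close>

lemma szego_lower_bound:
  assumes \<mu>: "radon_measure_circle \<mu>" and P: "poly P 0 = 1"
  shows "szego_constant \<mu> \<le> (\<integral>\<theta>. (cmod (poly P (cis \<theta>)))\<^sup>2 \<partial>\<mu>)"
proof -
  let ?w = "RN_deriv haar_circle (ac_part haar_circle \<mu>)"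
  let ?p = "\<lambda>\<theta>. (cmod (poly P (cis \<theta>)))\<^sup>2"
  define g where "g n \<theta> = clamp_log n (ext_log (?w \<theta>))" for n \<theta>
  interpret m: prob_space haar_circle by (rule prob_space_haar_circle)
  interpret \<mu>: finite_measure \<mu> using \<mu> by (simp add: radon_measure_circle_def)
  note [measurable] = borel_measurable_poly_cis[OF haar_circle_radon] borel_measurable_poly_cis[OF \<mu>]
  have gm[measurable]: "g n \<in> borel_measurable haar_circle" for n unfolding g_def by measurable
  have gb: "\<bar>g n \<theta>\<bar> \<le> real n" for n \<theta> unfolding g_def by (rule abs_clamp_log_le)
  note int = integrable_poly_cis(2)[OF \<mu>, of P] integrable_poly_cis(2)[OF haar_circle_radon, of P]
  obtain B where B: "\<And>f. f\<in>borel_measurable haar_circle \<Longrightarrow>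
      (\<integral>\<^sup>+\<theta>. ?w \<theta> * f \<theta> \<partial>haar_circle) = (\<integral>\<^sup>+\<theta>. indicator (space haar_circle - B) \<theta> * f \<theta> \<partial>\<mu>)"
    using ac_part_nn_integral[OF \<mu>] by blast
  have "exp (\<integral>\<theta>. g n \<theta> \<partial>haar_circle) \<le> (\<integral>\<theta>. ?p \<theta> \<partial>\<mu>) + exp (- real n) * (\<integral>\<theta>. ?p \<theta> \<partial>haar_circle)" for n
  proof -
    have "ennreal (exp (\<integral>\<theta>. g n \<theta> \<partial>haar_circle)) \<le> ennreal (\<integral>\<theta>. ?p \<theta> * exp (g n \<theta>) \<partial>haar_circle)"
      by (intro ennreal_leI weighted_L2_lower_bound[OF gm gb P])
    also have "\<dots> \<le> (\<integral>\<^sup>+\<theta>. ennreal (?p \<theta> * exp (g n \<theta>)) \<partial>haar_circle)"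
      by (subst integral_eq_nn_integral) (auto simp: ennreal_enn2real_if)
    also have "\<dots> \<le> (\<integral>\<^sup>+\<theta>. ?w \<theta> * ennreal (?p \<theta>) + ennreal (exp (- real n)) * ennreal (?p \<theta>) \<partial>haar_circle)"
    proof (rule nn_integral_mono)
      fix \<theta>
      have "ennreal (?p \<theta> * exp (g n \<theta>)) = ennreal (exp (g n \<theta>)) * ennreal (?p \<theta>)"
        by (simp add: ennreal_mult mult.commute)
      also have "\<dots> \<le> (?w \<theta> + ennreal (exp (- real n))) * ennreal (?p \<theta>)"
        unfolding g_def by (intro mult_right_mono exp_clamp_log_le) simp
      finally show "ennreal (?p \<theta> * exp (g n \<theta>)) \<le> ?w \<theta> * ennreal (?p \<theta>) + ennreal (exp (- real n)) * ennreal (?p \<theta>)"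
        by (simp add: distrib_right)
    qed
    also have "\<dots> = (\<integral>\<^sup>+\<theta>. ?w \<theta> * ennreal (?p \<theta>) \<partial>haar_circle) + ennreal (exp (- real n)) * (\<integral>\<^sup>+\<theta>. ennreal (?p \<theta>) \<partial>haar_circle)"
      by (simp add: nn_integral_add nn_integral_cmult)
    also have "\<dots> \<le> (\<integral>\<^sup>+\<theta>. ennreal (?p \<theta>) \<partial>\<mu>) + ennreal (exp (- real n)) * (\<integral>\<^sup>+\<theta>. ennreal (?p \<theta>) \<partial>haar_circle)"
      by (subst B) (auto intro!: add_right_mono nn_integral_mono split: split_indicator)
    also have "\<dots> = ennreal ((\<integral>\<theta>. ?p \<theta> \<partial>\<mu>) + exp (- real n) * (\<integral>\<theta>. ?p \<theta> \<partial>haar_circle))"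
      using int by (simp add: nn_integral_eq_integral ennreal_mult)
    finally show ?thesis by (subst (asm) ennreal_le_iff) (auto intro!: add_nonneg_nonneg mult_nonneg_nonneg)
  qed
  moreover have "(\<lambda>n. (\<integral>\<theta>. ?p \<theta> \<partial>\<mu>) + exp (- real n) * (\<integral>\<theta>. ?p \<theta> \<partial>haar_circle)) \<longlonglongrightarrow> (\<integral>\<theta>. ?p \<theta> \<partial>\<mu>) + 0 * (\<integral>\<theta>. ?p \<theta> \<partial>haar_circle)"
    by (intro tendsto_intros) (rule filterlim_compose[OF exp_at_bot], intro filterlim_uminus_at_bot[THEN iffD2], simp add: filterlim_real_sequentially)
  ultimately show ?thesis
    using LIMSEQ_le[OF exp_clamp_log_integral_tendsto[OF \<mu>]] unfolding g_def by fastforce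
qed

text \<open>
  The weight \<open>exp g\<close> is the reciprocal of the truncated density away from \<open>B\<close>, which makes the
  contribution of the absolutely continuous part at most about \<open>1\<close>, and it is \<open>exp (-n)\<close> on \<open>B\<close>, which makes
  the singular part negligible. The change on \<open>B\<close> does not affect the Haar mean of \<open>g\<close>.
\<close>

lemma szego_upper_bound:
  assumes \<mu>: "radon_measure_circle \<mu>" and e: "e > 0"
  shows "\<exists>P. poly P 0 = 1 \<and> (\<integral>\<theta>. (cmod (poly P (cis \<theta>)))\<^sup>2 \<partial>\<mu>) < szego_constant \<mu> + e"
proof -
  let ?w = "RN_deriv haar_circle (ac_part haar_circle \<mu>)"
  define c where "c n = (\<integral>\<theta>. clamp_log n (ext_log (?w \<theta>)) \<partial>haar_circle)" for n
  interpret m: prob_space haar_circle by (rule prob_space_haar_circle)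
  interpret \<mu>: finite_measure \<mu> using \<mu> by (simp add: radon_measure_circle_def)
  have s: "sets \<mu> = sets haar_circle" using \<mu> haar_circle_radon by (simp add: radon_measure_circle_def)
  have sp: "space \<mu> = space haar_circle" using s by (rule sets_eq_imp_space_eq)
  have "(\<lambda>n. exp (c n) * (1 + exp (- real n) * measure \<mu> (space \<mu>))) \<longlonglongrightarrow>
      szego_constant \<mu> * (1 + 0 * measure \<mu> (space \<mu>))"
    using exp_clamp_log_integral_tendsto[OF \<mu>] unfolding c_def
    by (intro tendsto_intros) (auto intro!: filterlim_compose[OF exp_at_bot] filterlim_uminus_at_bot[THEN iffD2] filterlim_real_sequentially)
  then have "eventually (\<lambda>n. exp (c n) * (1 + exp (- real n) * measure \<mu> (space \<mu>)) < szego_constant \<mu> + e/2) sequentially"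
    using e by (intro order_tendstoD) auto
  then obtain n where n: "exp (c n) * (1 + exp (- real n) * measure \<mu> (space \<mu>)) < szego_constant \<mu> + e/2"
    by (auto simp: eventually_sequentially)
  obtain B where B[measurable]: "B \<in> sets haar_circle" and B0: "emeasure haar_circle B = 0" and Bw: "\<And>f. f\<in>borel_measurable haar_circle \<Longrightarrow>
      (\<integral>\<^sup>+\<theta>. ?w \<theta> * f \<theta> \<partial>haar_circle) = (\<integral>\<^sup>+\<theta>. indicator (space haar_circle - B) \<theta> * f \<theta> \<partial>\<mu>)"
    using ac_part_nn_integral[OF \<mu>] by blast
  have B\<mu>[measurable]: "B \<in> sets \<mu>" by (simp add: s)
  \<comment> \<open>on \<open>B\<close> the weight only has to be small; the value \<open>- n\<close> keeps \<open>\<bar>g\<bar>\<close> bounded by \<open>n\<close>\<close>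
  define g where "g \<theta> = (if \<theta> \<in> B then - real n else - clamp_log n (ext_log (?w \<theta>)))" for \<theta>
  have [measurable]: "g \<in> borel_measurable haar_circle" unfolding g_def by measurable
  then have [measurable]: "g \<in> borel_measurable \<mu>" by (simp add: measurable_cong_sets[OF s refl])
  have gb: "\<bar>g \<theta>\<bar> \<le> real n" for \<theta> using abs_clamp_log_le[of n] by (simp add: g_def)
  have "(\<integral>\<theta>. g \<theta> \<partial>haar_circle) = (\<integral>\<theta>. - clamp_log n (ext_log (?w \<theta>)) \<partial>haar_circle)"
  proof (rule integral_cong_AE)
    have "B \<in> null_sets haar_circle" using B B0 by (simp add: null_sets_def)
    then have "AE \<theta> in haar_circle. \<theta> \<notin> B" by (rule AE_not_in)
    then show "AE \<theta> in haar_circle. g \<theta> = - clamp_log n (ext_log (?w \<theta>))"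
      by eventually_elim (simp add: g_def)
  qed measurable
  then have ig: "(\<integral>\<theta>. g \<theta> \<partial>haar_circle) = - c n" by (simp add: c_def)
  have int: "integrable \<mu> (\<lambda>\<theta>. exp (g \<theta>))"
  proof (rule \<mu>.integrable_const_bound[where B="exp (real n)"])
    have "g \<theta> \<le> real n" for \<theta> using gb[of \<theta>] by linarith
    then show "AE \<theta> in \<mu>. norm (exp (g \<theta>)) \<le> exp (real n)" by simp
  qed measurable
  have "(\<integral>\<^sup>+\<theta>. indicator (space haar_circle - B) \<theta> * ennreal (exp (g \<theta>)) \<partial>\<mu>)
     = (\<integral>\<^sup>+\<theta>. indicator (space haar_circle - B) \<theta> * ennreal (exp (- clamp_log n (ext_log (?w \<theta>)))) \<partial>\<mu>)"
    by (intro nn_integral_cong) (auto simp: g_def split: split_indicator)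
  also have "\<dots> = (\<integral>\<^sup>+\<theta>. ?w \<theta> * ennreal (exp (- clamp_log n (ext_log (?w \<theta>)))) \<partial>haar_circle)"
    by (rule Bw[symmetric]) measurable
  also have "\<dots> \<le> (\<integral>\<^sup>+\<theta>. 1 + ?w \<theta> * ennreal (exp (- real n)) \<partial>haar_circle)"
    by (intro nn_integral_mono mult_exp_minus_clamp_log_le)
  also have "\<dots> = 1 + (\<integral>\<^sup>+\<theta>. ?w \<theta> * ennreal (exp (- real n)) \<partial>haar_circle)"
    by (subst nn_integral_add) (auto simp: m.emeasure_space_1)
  also have "(\<integral>\<^sup>+\<theta>. ?w \<theta> * ennreal (exp (- real n)) \<partial>haar_circle) = emeasure \<mu> (space \<mu> - B) * ennreal (exp (- real n))"
    by (subst Bw) (simp_all add: sp[symmetric] nn_integral_multc)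
  finally have ac: "(\<integral>\<^sup>+\<theta>. indicator (space haar_circle - B) \<theta> * ennreal (exp (g \<theta>)) \<partial>\<mu>)
     \<le> 1 + ennreal (exp (- real n)) * emeasure \<mu> (space \<mu> - B)" by (simp add: mult.commute)
  have "ennreal (\<integral>\<theta>. exp (g \<theta>) \<partial>\<mu>) = (\<integral>\<^sup>+\<theta>. ennreal (exp (g \<theta>)) \<partial>\<mu>)"
    using int by (simp add: nn_integral_eq_integral)
  also have "\<dots> = (\<integral>\<^sup>+\<theta>. indicator (space haar_circle - B) \<theta> * ennreal (exp (g \<theta>)) +
      indicator B \<theta> * ennreal (exp (- real n)) \<partial>\<mu>)"
    by (intro nn_integral_cong) (auto simp: sp g_def split: split_indicator)
  also have "\<dots> = (\<integral>\<^sup>+\<theta>. indicator (space haar_circle - B) \<theta> * ennreal (exp (g \<theta>)) \<partial>\<mu>) +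
      ennreal (exp (- real n)) * emeasure \<mu> B"
    by (subst nn_integral_add) (auto simp: sp[symmetric] nn_integral_multc mult.commute)
  also have "\<dots> \<le> (1 + ennreal (exp (- real n)) * emeasure \<mu> (space \<mu> - B)) + ennreal (exp (- real n)) * emeasure \<mu> B"
    by (intro add_right_mono ac)
  also have "\<dots> = 1 + ennreal (exp (- real n)) * (emeasure \<mu> (space \<mu> - B) + emeasure \<mu> B)"
    by (simp add: distrib_left add.assoc)
  also have "emeasure \<mu> (space \<mu> - B) + emeasure \<mu> B = emeasure \<mu> (space \<mu>)"
    using sets.sets_into_space[OF B\<mu>] by (subst plus_emeasure) (auto simp: Un_absorb2)
  also have "1 + ennreal (exp (- real n)) * emeasure \<mu> (space \<mu>) = ennreal (1 + exp (- real n) * measure \<mu> (space \<mu>))"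
    by (simp add: \<mu>.emeasure_eq_measure ennreal_mult)
  finally have up: "(\<integral>\<theta>. exp (g \<theta>) \<partial>\<mu>) \<le> 1 + exp (- real n) * measure \<mu> (space \<mu>)"
    by (subst (asm) ennreal_le_iff) (auto intro!: add_nonneg_nonneg mult_nonneg_nonneg)
  obtain P where P: "poly P 0 = 1" "(\<integral>\<theta>. (cmod (poly P (cis \<theta>)))\<^sup>2 \<partial>\<mu>)
     < exp (- (\<integral>\<theta>. g \<theta> \<partial>haar_circle)) * (\<integral>\<theta>. exp (g \<theta>) \<partial>\<mu>) + e/2"
    using poly_L2_upper_bound[where g=g and e="e/2", OF \<mu> _ gb] e by auto
  have "exp (- (\<integral>\<theta>. g \<theta> \<partial>haar_circle)) * (\<integral>\<theta>. exp (g \<theta>) \<partial>\<mu>) \<le> exp (c n) * (1 + exp (- real n) * measure \<mu> (space \<mu>))"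
    unfolding ig using up by simp
  then show ?thesis using P n by (intro exI[of _ P]) simp
qed

section \<open>The branches of the tree\<close>

definition branch_ray :: "nat \<Rightarrow> nat \<Rightarrow> nat list" where
  "branch_ray i n = (case n of 0 \<Rightarrow> [] | Suc k \<Rightarrow> i # replicate k 0)"

lemma branch_ray_0 [simp]: "branch_ray i 0 = []"
  and branch_ray_Suc [simp]: "branch_ray i (Suc n) = i # replicate n 0"
  by (simp_all add: branch_ray_def)

lemma length_branch_ray [simp]: "length (branch_ray i n) = n"
  by (cases n) simp_all

lemma branch_ray_in_tree: "i < q \<Longrightarrow> branch_ray i n \<in> tree_q1 q"
  by (cases n) (auto simp: tree_q1_def)

lemma tree_q1_minus_root: "tree_q1 q - {[]} = (\<lambda>(i, n). branch_ray i n) ` ({..<q} \<times> {1..})"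
proof (intro equalityI subsetI)
  fix u assume "u \<in> tree_q1 q - {[]}"
  then obtain i n where "i < q" "u = branch_ray i (Suc n)" by (auto simp: tree_q1_def)
  then show "u \<in> (\<lambda>(i, n). branch_ray i n) ` ({..<q} \<times> {1..})"
    by (intro image_eqI[of _ _ "(i, Suc n)"]) auto
next
  fix u assume "u \<in> (\<lambda>(i, n). branch_ray i n) ` ({..<q} \<times> {1..})"
  then obtain i n where "i < q" "u = branch_ray i (Suc n)"
    by (auto simp: Suc_le_eq gr0_conv_Suc)
  then show "u \<in> tree_q1 q - {[]}" by (auto simp: tree_q1_def)
qed

lemma inj_on_branch_ray: "inj_on (\<lambda>(i, n). branch_ray i n) (UNIV \<times> {1..})"
proof (rule inj_onI)
  fix x y :: "nat \<times> nat"
  assume *: "x \<in> UNIV \<times> {1..}" "y \<in> UNIV \<times> {1..}"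
    "(case x of (i, n) \<Rightarrow> branch_ray i n) = (case y of (i, n) \<Rightarrow> branch_ray i n)"
  obtain i m j n where x: "x = (i, Suc m)" and y: "y = (j, Suc n)"
    using *(1,2) by (cases x; cases y) (auto simp: Suc_le_eq gr0_conv_Suc)
  then have eq: "branch_ray i (Suc m) = branch_ray j (Suc n)" using *(3) by (simp only: case_prod_conv)
  from arg_cong[OF eq, of length] have "m = n" by simp
  with eq show "x = y" by (simp add: x y)
qed

lemma tree_adj_sym: "tree_adj V u v \<Longrightarrow> tree_adj V v u"
  by (auto simp: tree_adj_def)

lemma relpowp_tree_adj_sym: "(tree_adj V ^^ n) u v \<Longrightarrow> (tree_adj V ^^ n) v u"
proof (induction n arbitrary: v)
  case (Suc n)
  then obtain w where "(tree_adj V ^^ n) u w" "tree_adj V w v" by auto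
  then show ?case using relpowp_Suc_I2[OF tree_adj_sym Suc.IH] by blast
qed simp

text \<open>
  An edge changes the level by one; this bounds tree distances from below.
\<close>

lemma relpowp_tree_adj_length:
  "(tree_adj V ^^ n) u v \<Longrightarrow> \<bar>int (length u) - int (length v)\<bar> \<le> int n"
proof (induction n arbitrary: v)
  case (Suc n)
  then obtain w where w: "(tree_adj V ^^ n) u w" "tree_adj V w v" by auto
  then have "\<bar>int (length w) - int (length v)\<bar> \<le> 1"
    by (auto simp: tree_adj_def children_def)
  then show ?case using Suc.IH[OF w(1)] by simp
qed simp

text \<open>
  The minimum defining \<open>tree_dist\<close> is attained as soon as some path exists.
\<close>

lemma tree_dist_relpowp: "(tree_adj V ^^ n) u v \<Longrightarrow> (tree_adj V ^^ tree_dist V u v) u v"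
  unfolding tree_dist_def by (rule LeastI)

lemma branch_ray_step:
  assumes "i < q" shows "tree_adj (tree_q1 q) (branch_ray i n) (branch_ray i (Suc n))"
proof -
  have "\<exists>j. branch_ray i (Suc n) = branch_ray i n @ [j]"
  proof (cases n)
    case (Suc m)
    then show ?thesis by (intro exI[of _ 0]) (simp add: replicate_append_same)
  qed simp
  then have "branch_ray i (Suc n) \<in> children (tree_q1 q) (branch_ray i n)"
    unfolding children_def using branch_ray_in_tree[OF assms, of "Suc n"] by blast
  then show ?thesis
    unfolding tree_adj_def using branch_ray_in_tree[OF assms] by blast
qed

lemma branch_ray_path:
  assumes "i < q" shows "(tree_adj (tree_q1 q) ^^ k) (branch_ray i n) (branch_ray i (n + k))"
proof (induction k)
  case (Suc k)
  then show ?case using branch_ray_step[OF assms, of "n + k"] by auto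
qed simp

lemma tree_dist_branch_ray:
  assumes "i < q"
  shows "int (tree_dist (tree_q1 q) (branch_ray i m) (branch_ray i n)) = \<bar>int m - int n\<bar>"
proof -
  define d where "d = nat \<bar>int m - int n\<bar>"
  have path: "(tree_adj (tree_q1 q) ^^ d) (branch_ray i m) (branch_ray i n)"
  proof (cases "m \<le> n")
    case True
    then show ?thesis using branch_ray_path[OF assms, of "n - m" m] by (simp add: d_def nat_diff_distrib)
  next
    case False
    then show ?thesis using relpowp_tree_adj_sym[OF branch_ray_path[OF assms, of "m - n" n]]
      by (simp add: d_def nat_diff_distrib)
  qed
  then have "tree_dist (tree_q1 q) (branch_ray i m) (branch_ray i n) \<le> d"
    unfolding tree_dist_def by (rule Least_le)
  moreover have "\<bar>int m - int n\<bar> \<le> int (tree_dist (tree_q1 q) (branch_ray i m) (branch_ray i n))"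
    using relpowp_tree_adj_length[OF tree_dist_relpowp[OF path]] by simp
  ultimately show ?thesis by (simp add: d_def)
qed

lemma branch_ray_rooted: "i < q \<Longrightarrow> branch_ray i \<in> rooted_rays (tree_q1 q)"
  by (simp add: rooted_rays_def image_subset_iff branch_ray_in_tree tree_dist_branch_ray)

lemma tree_q1_cases:
  assumes "u \<in> tree_q1 q" "q > 0"
  obtains i n where "i < q" "u = branch_ray i n"
proof (cases "u = []")
  case True
  then show ?thesis using that[of 0 0] assms by simp
next
  case False
  then have "u \<in> (\<lambda>(i, n). branch_ray i n) ` ({..<q} \<times> {1..})"
    using assms(1) by (subst tree_q1_minus_root[symmetric]) simp
  then show ?thesis using that by auto
qed

text \<open>
  A ray is at level \<open>n\<close> after \<open>n\<close> steps because it moves away from the root, hence each step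
  appends one letter, and appending to a nonempty word keeps its first letter.
\<close>

lemma rooted_ray_same_branch:
  assumes "q > 0" and \<xi>: "\<xi> \<in> rooted_rays (tree_q1 q)"
  shows "length (\<xi> n) = n" "hd (\<xi> (Suc n)) = hd (\<xi> 1)"
proof -
  let ?V = "tree_q1 q"
  have V: "\<xi> n \<in> ?V" and root: "\<xi> 0 = []" and dist: "int (tree_dist ?V (\<xi> m) (\<xi> n)) = \<bar>int m - int n\<bar>" for m n
    using \<xi> unfolding rooted_rays_def by auto
  have path: "(tree_adj ?V ^^ length u) [] u" if u: "u \<in> ?V" for u
  proof -
    obtain i m where "i < q" "u = branch_ray i m" using tree_q1_cases[OF u assms(1)] .
    then show ?thesis using branch_ray_path[of i q m 0] by simp
  qed
  show len: "length (\<xi> n) = n" for n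
  proof -
    obtain i m where i: "i < q" "\<xi> n = branch_ray i m" using tree_q1_cases[OF V assms(1)] .
    then have "int n = int m" using dist[of 0 n] tree_dist_branch_ray[OF i(1), of 0 m] root by simp
    then show ?thesis using i by simp
  qed
  have step: "\<exists>k. \<xi> (Suc n) = \<xi> n @ [k]" for n
  proof -
    have "(tree_adj ?V ^^ (length (\<xi> n) + length (\<xi> (Suc n)))) (\<xi> n) (\<xi> (Suc n))"
      using relpowp_trans[OF relpowp_tree_adj_sym[OF path[OF V]] path[OF V]] .
    from tree_dist_relpowp[OF this] have "tree_adj ?V (\<xi> n) (\<xi> (Suc n))"
      using dist[of n "Suc n"] by (simp add: eq_OO)
    then show ?thesis using len[of n] len[of "Suc n"] by (auto simp: tree_adj_def children_def)
  qed
  show "hd (\<xi> (Suc n)) = hd (\<xi> 1)"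
  proof (induction n)
    case (Suc n)
    have "\<xi> (Suc n) \<noteq> []" using len[of "Suc n"] by auto
    moreover obtain k where "\<xi> (Suc (Suc n)) = \<xi> (Suc n) @ [k]" using step by blast
    ultimately show ?case using Suc by simp
  qed simp
qed

lemma branches_not_comparable:
  assumes "i \<noteq> j" "q > 0"
  shows "\<not> comparable (tree_q1 q) (branch_ray i (Suc a)) (branch_ray j (Suc b))"
proof
  assume "comparable (tree_q1 q) (branch_ray i (Suc a)) (branch_ray j (Suc b))"
  then obtain \<xi> m n where \<xi>: "\<xi> \<in> rooted_rays (tree_q1 q)"
    and m: "branch_ray i (Suc a) = \<xi> m" and n: "branch_ray j (Suc b) = \<xi> n"
    unfolding comparable_def by blast
  note ray = rooted_ray_same_branch[OF assms(2) \<xi>]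
  have "m = Suc a" "n = Suc b"
    using ray(1)[of m] ray(1)[of n] length_branch_ray[of i "Suc a"] length_branch_ray[of j "Suc b"]
    by (simp_all only: m n)
  then have "hd (branch_ray i (Suc a)) = hd (\<xi> 1)" "hd (branch_ray j (Suc b)) = hd (\<xi> 1)"
    using ray(2)[of a] ray(2)[of b] by (simp_all only: m n)
  then show False using assms(1) by simp
qed

section \<open>Distances in spaces of square-integrable functions\<close>

lemma L2_integrable_mult_cnj:
  assumes "f \<in> L2_space P" "g \<in> L2_space P"
  shows "integrable P (\<lambda>\<omega>. f \<omega> * cnj (g \<omega>))"
proof (rule Bochner_Integration.integrable_bound)
  show "integrable P (\<lambda>\<omega>. (cmod (f \<omega>))\<^sup>2 + (cmod (g \<omega>))\<^sup>2)"
    using assms by (auto simp: L2_space_def)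
  have [measurable]: "f \<in> borel_measurable P" "g \<in> borel_measurable P"
    using assms by (auto simp: L2_space_def)
  have [measurable]: "(\<lambda>\<omega>. cnj (g \<omega>)) \<in> borel_measurable P"
    by (rule measurable_compose[OF _ borel_measurable_continuous_onI]) (auto intro!: continuous_intros)
  show "(\<lambda>\<omega>. f \<omega> * cnj (g \<omega>)) \<in> borel_measurable P" by measurable
  have "a * b \<le> a\<^sup>2 + b\<^sup>2" if "a \<ge> 0" "b \<ge> 0" for a b :: real
    using sum_squares_bound[of a b] that mult_nonneg_nonneg[OF that] by linarith
  then show "AE \<omega> in P. norm (f \<omega> * cnj (g \<omega>)) \<le> norm ((cmod (f \<omega>))\<^sup>2 + (cmod (g \<omega>))\<^sup>2)"
    by (simp add: norm_mult)
qed

lemma L2_space_add: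
  assumes "f \<in> L2_space P" "g \<in> L2_space P"
  shows "(\<lambda>\<omega>. f \<omega> + g \<omega>) \<in> L2_space P"
proof -
  have [measurable]: "f \<in> borel_measurable P" "g \<in> borel_measurable P"
    and [simp]: "integrable P (\<lambda>\<omega>. (cmod (f \<omega>))\<^sup>2)" "integrable P (\<lambda>\<omega>. (cmod (g \<omega>))\<^sup>2)"
    using assms by (auto simp: L2_space_def)
  have "(cmod (a + b))\<^sup>2 \<le> 2 * (cmod a)\<^sup>2 + 2 * (cmod b)\<^sup>2" for a b :: complex
  proof -
    have "(cmod (a + b))\<^sup>2 \<le> (cmod a + cmod b)\<^sup>2" by (intro power_mono norm_triangle_ineq) simp
    also have "\<dots> \<le> 2 * (cmod a)\<^sup>2 + 2 * (cmod b)\<^sup>2"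
      using sum_squares_bound[of "cmod a" "cmod b"] by (simp add: power2_sum)
    finally show ?thesis .
  qed
  then have "AE \<omega> in P. norm ((cmod (f \<omega> + g \<omega>))\<^sup>2) \<le> norm (2 * (cmod (f \<omega>))\<^sup>2 + 2 * (cmod (g \<omega>))\<^sup>2)" by simp
  then have "integrable P (\<lambda>\<omega>. (cmod (f \<omega> + g \<omega>))\<^sup>2)"
    by (rule Bochner_Integration.integrable_bound[rotated 2]) simp_all
  then show ?thesis by (simp add: L2_space_def)
qed

lemma L2_space_cmult: "f \<in> L2_space P \<Longrightarrow> (\<lambda>\<omega>. c * f \<omega>) \<in> L2_space P"
  by (auto simp: L2_space_def norm_mult power_mult_distrib)

lemma L2_space_sum:
  assumes "\<And>i. i \<in> I \<Longrightarrow> f i \<in> L2_space P"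
  shows "(\<lambda>\<omega>. \<Sum>i\<in>I. f i \<omega>) \<in> L2_space P"
proof (cases "finite I")
  case True
  then show ?thesis using assms
  proof (induction I)
    case (insert i I)
    then show ?case using L2_space_add[of "f i" P "\<lambda>\<omega>. \<Sum>i\<in>I. f i \<omega>"] by simp
  qed (simp add: L2_space_def)
qed (simp add: L2_space_def)

lemma L2_space_diff:
  assumes "f \<in> L2_space P" "g \<in> L2_space P"
  shows "(\<lambda>\<omega>. f \<omega> - g \<omega>) \<in> L2_space P"
  using L2_space_add[OF assms(1) L2_space_cmult[OF assms(2), of "-1"]] by simp

lemma Cov_sum_left:
  assumes "\<And>i. i \<in> I \<Longrightarrow> f i \<in> L2_space P" "g \<in> L2_space P"
  shows "Cov P (\<lambda>\<omega>. \<Sum>i\<in>I. f i \<omega>) g = (\<Sum>i\<in>I. Cov P (f i) g)"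
  unfolding Cov_def sum_distrib_right using assms
  by (intro Bochner_Integration.integral_sum L2_integrable_mult_cnj) auto

lemma Cov_cmult_left: "Cov P (\<lambda>\<omega>. c * f \<omega>) g = c * Cov P f g"
  unfolding Cov_def by (simp add: mult.assoc)

lemma Cov_commute: "Cov P g f = cnj (Cov P f g)"
proof -
  have "cnj (Cov P f g) = (\<integral>\<omega>. cnj (f \<omega> * cnj (g \<omega>)) \<partial>P)"
    unfolding Cov_def by (rule Bochner_Integration.integral_cnj[symmetric])
  then show ?thesis by (simp add: Cov_def mult.commute)
qed

lemma Cov_linear_combination:
  assumes "\<And>i. i \<in> I \<Longrightarrow> f i \<in> L2_space P" "\<And>j. j \<in> J \<Longrightarrow> g j \<in> L2_space P"
  shows "Cov P (\<lambda>\<omega>. \<Sum>i\<in>I. a i * f i \<omega>) (\<lambda>\<omega>. \<Sum>j\<in>J. b j * g j \<omega>)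
    = (\<Sum>i\<in>I. \<Sum>j\<in>J. a i * cnj (b j) * Cov P (f i) (g j))"
proof -
  have gJ: "(\<lambda>\<omega>. \<Sum>j\<in>J. b j * g j \<omega>) \<in> L2_space P" by (intro L2_space_sum L2_space_cmult assms)
  have right: "Cov P (f i) (\<lambda>\<omega>. \<Sum>j\<in>J. b j * g j \<omega>) = (\<Sum>j\<in>J. cnj (b j) * Cov P (f i) (g j))" if "i \<in> I" for i
  proof -
    have "Cov P (\<lambda>\<omega>. \<Sum>j\<in>J. b j * g j \<omega>) (f i) = (\<Sum>j\<in>J. b j * Cov P (g j) (f i))"
      using assms that by (subst Cov_sum_left) (auto intro: L2_space_cmult simp: Cov_cmult_left)
    then show ?thesis
      by (subst Cov_commute) (simp add: Cov_commute[of P "g _" "f i"])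
  qed
  have "Cov P (\<lambda>\<omega>. \<Sum>i\<in>I. a i * f i \<omega>) (\<lambda>\<omega>. \<Sum>j\<in>J. b j * g j \<omega>)
    = (\<Sum>i\<in>I. a i * Cov P (f i) (\<lambda>\<omega>. \<Sum>j\<in>J. b j * g j \<omega>))"
    using assms gJ by (subst Cov_sum_left) (auto intro: L2_space_cmult simp: Cov_cmult_left)
  then show ?thesis using right by (simp add: sum_distrib_left mult.assoc)
qed

lemma integral_cmod_square: "of_real (\<integral>\<omega>. (cmod (f \<omega>))\<^sup>2 \<partial>P) = Cov P f f"
  unfolding Cov_def by (simp add: complex_norm_square flip: integral_complex_of_real of_real_power)

lemma integral_cmod_square_diff:
  assumes "f \<in> L2_space P" "g \<in> L2_space P"
  shows "(\<integral>\<omega>. (cmod (f \<omega> - g \<omega>))\<^sup>2 \<partial>P) =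
    (\<integral>\<omega>. (cmod (f \<omega>))\<^sup>2 \<partial>P) + (\<integral>\<omega>. (cmod (g \<omega>))\<^sup>2 \<partial>P) - 2 * Re (Cov P f g)"
proof -
  define h where "h \<omega> = Re (f \<omega> * cnj (g \<omega>))" for \<omega>
  have h: "integrable P h" "Re (Cov P f g) = (\<integral>\<omega>. h \<omega> \<partial>P)"
    unfolding Cov_def h_def[abs_def] using L2_integrable_mult_cnj[OF assms]
    by (rule integrable_Re, rule integral_Re[symmetric])
  have "(cmod (a - b))\<^sup>2 = (cmod a)\<^sup>2 + (cmod b)\<^sup>2 - 2 * Re (a * cnj b)" for a b
    by (simp add: cmod_power2 power2_diff algebra_simps)
  then have "(\<integral>\<omega>. (cmod (f \<omega> - g \<omega>))\<^sup>2 \<partial>P) = (\<integral>\<omega>. (cmod (f \<omega>))\<^sup>2 + (cmod (g \<omega>))\<^sup>2 - 2 * h \<omega> \<partial>P)"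
    unfolding h_def by simp
  then show ?thesis using assms h by (simp add: L2_space_def)
qed

text \<open>
  By orthogonality the only mixed terms in the expanded square are those of \<open>e\<close> with a single
  \<open>g i\<close>, so every \<open>g i\<close> changes the squared distance by the same amount as if it were alone.
\<close>

lemma orthogonal_sum_distance:
  assumes "finite I" and e: "e \<in> L2_space P" and g: "\<And>i. i \<in> I \<Longrightarrow> g i \<in> L2_space P"
    and orth: "\<And>i j. i \<in> I \<Longrightarrow> j \<in> I \<Longrightarrow> i \<noteq> j \<Longrightarrow> Cov P (g i) (g j) = 0"
  shows "(\<integral>\<omega>. (cmod (e \<omega> - (\<Sum>i\<in>I. g i \<omega>)))\<^sup>2 \<partial>P) = (\<integral>\<omega>. (cmod (e \<omega>))\<^sup>2 \<partial>P) +
    (\<Sum>i\<in>I. (\<integral>\<omega>. (cmod (e \<omega> - g i \<omega>))\<^sup>2 \<partial>P) - (\<integral>\<omega>. (cmod (e \<omega>))\<^sup>2 \<partial>P))"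
  using assms(1) g orth
proof (induction I)
  case (insert j I)
  let ?S = "\<lambda>\<omega>. \<Sum>i\<in>I. g i \<omega>"
  have S: "?S \<in> L2_space P" using insert.prems by (intro L2_space_sum) auto
  have gj: "g j \<in> L2_space P" using insert.prems by auto
  have "Cov P ?S (g j) = 0"
    using insert by (subst Cov_sum_left) (auto intro!: sum.neutral)
  moreover have "Cov P (\<lambda>\<omega>. e \<omega> - ?S \<omega>) (g j) = Cov P e (g j) - Cov P ?S (g j)"
    unfolding Cov_def left_diff_distrib
    by (intro Bochner_Integration.integral_diff L2_integrable_mult_cnj e S gj)
  moreover have "(\<integral>\<omega>. (cmod (e \<omega> - (\<Sum>i\<in>insert j I. g i \<omega>)))\<^sup>2 \<partial>P) = (\<integral>\<omega>. (cmod ((e \<omega> - ?S \<omega>) - g j \<omega>))\<^sup>2 \<partial>P)"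
    using insert.hyps by (simp add: algebra_simps)
  ultimately have "(\<integral>\<omega>. (cmod (e \<omega> - (\<Sum>i\<in>insert j I. g i \<omega>)))\<^sup>2 \<partial>P) = (\<integral>\<omega>. (cmod (e \<omega> - ?S \<omega>))\<^sup>2 \<partial>P)
      + (\<integral>\<omega>. (cmod (g j \<omega>))\<^sup>2 \<partial>P) - 2 * Re (Cov P e (g j))"
    by (simp only: integral_cmod_square_diff[OF L2_space_diff[OF e S] gj]) simp
  also have "(\<integral>\<omega>. (cmod (e \<omega> - ?S \<omega>))\<^sup>2 \<partial>P) = (\<integral>\<omega>. (cmod (e \<omega>))\<^sup>2 \<partial>P) +
    (\<Sum>i\<in>I. (\<integral>\<omega>. (cmod (e \<omega> - g i \<omega>))\<^sup>2 \<partial>P) - (\<integral>\<omega>. (cmod (e \<omega>))\<^sup>2 \<partial>P))"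
    using insert by auto
  finally show ?case
    using insert.hyps integral_cmod_square_diff[OF e gj] by simp
qed simp

text \<open>
  With \<open>v\<close> small compared to \<open>t\<close>, and \<open>t\<close> small, this is a continuity estimate for the squared
  distance; it takes the place of the triangle inequality.
\<close>

lemma integral_cmod_square_add_le:
  assumes "u \<in> L2_space P" "v \<in> L2_space P" "t > 0"
  shows "(\<integral>\<omega>. (cmod (u \<omega> + v \<omega>))\<^sup>2 \<partial>P) \<le>
    (1 + t) * (\<integral>\<omega>. (cmod (u \<omega>))\<^sup>2 \<partial>P) + (1 + 1 / t) * (\<integral>\<omega>. (cmod (v \<omega>))\<^sup>2 \<partial>P)"
proof -
  have *: "(cmod (a + b))\<^sup>2 \<le> (1 + t) * (cmod a)\<^sup>2 + (1 + 1 / t) * (cmod b)\<^sup>2" for a b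
  proof -
    have "(cmod (a + b))\<^sup>2 \<le> (cmod a + cmod b)\<^sup>2" by (intro power_mono norm_triangle_ineq) simp
    also have "\<dots> = (1 + t) * (cmod a)\<^sup>2 + (1 + 1 / t) * (cmod b)\<^sup>2 - (t * cmod a - cmod b)\<^sup>2 / t"
      using assms(3) by (simp add: field_simps power2_eq_square)
    also have "\<dots> \<le> (1 + t) * (cmod a)\<^sup>2 + (1 + 1 / t) * (cmod b)\<^sup>2" using assms(3) by simp
    finally show ?thesis .
  qed
  have "(\<integral>\<omega>. (cmod (u \<omega> + v \<omega>))\<^sup>2 \<partial>P) \<le> (\<integral>\<omega>. (1 + t) * (cmod (u \<omega>))\<^sup>2 + (1 + 1 / t) * (cmod (v \<omega>))\<^sup>2 \<partial>P)"
    using * assms L2_space_add[OF assms(1,2)] by (intro integral_mono) (auto simp: L2_space_def)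
  also have "\<dots> = (1 + t) * (\<integral>\<omega>. (cmod (u \<omega>))\<^sup>2 \<partial>P) + (1 + 1 / t) * (\<integral>\<omega>. (cmod (v \<omega>))\<^sup>2 \<partial>P)"
    using assms by (simp add: L2_space_def)
  finally show ?thesis .
qed

text \<open>
  The linear span is indexed by functions, not by indices; if \<open>h\<close> takes a value several times,
  the coefficients belonging to this value are added up.
\<close>

lemma lin_span_sum:
  assumes "finite J" "\<And>j. j \<in> J \<Longrightarrow> h j \<in> S"
  shows "(\<lambda>\<omega>. \<Sum>j\<in>J. a j * h j \<omega>) \<in> lin_span S"
proof -
  have "(\<Sum>j\<in>J. a j * h j \<omega>) = (\<Sum>f\<in>h ` J. (\<Sum>j\<in>{j\<in>J. h j = f}. a j) * f \<omega>)" for \<omega>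
    by (subst sum.image_gen[OF assms(1), of _ h]) (simp add: sum_distrib_right)
  then show ?thesis
    unfolding lin_span_def using assms
    by (intro CollectI exI[of _ "h ` J"] exI[of _ "\<lambda>f. \<Sum>j\<in>{j\<in>J. h j = f}. a j"]) auto
qed

lemma lin_span_subset_L2:
  assumes "S \<subseteq> L2_space P" shows "lin_span S \<subseteq> L2_space P"
  using assms unfolding lin_span_def by (auto intro!: L2_space_sum L2_space_cmult)

text \<open>
  Passing from a span to its closure does not change distances, so bounds on the span suffice.
\<close>

lemma L2_setdist_closed_span:
  assumes S: "S \<subseteq> L2_space P" and x: "x \<in> L2_space P" 
    and lower: "\<And>g. g \<in> lin_span S \<Longrightarrow> R \<le> (\<integral>\<omega>. (cmod (x \<omega> - g \<omega>))\<^sup>2 \<partial>P)"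
    and upper: "\<And>\<epsilon>. \<epsilon> > 0 \<Longrightarrow> \<exists>g\<in>lin_span S. (\<integral>\<omega>. (cmod (x \<omega> - g \<omega>))\<^sup>2 \<partial>P) < R + \<epsilon>"
  shows "L2_setdist P x (L2_closed_span P S) = sqrt R"
proof -
  have span: "lin_span S \<subseteq> L2_closed_span P S"
    unfolding L2_closed_span_def using lin_span_subset_L2[OF S] by (auto intro!: bexI simp: L2_dist_def)
  have low: "sqrt R \<le> L2_dist P x f" if f: "f \<in> L2_closed_span P S" for f
  proof -
    let ?d = "\<integral>\<omega>. (cmod (x \<omega> - f \<omega>))\<^sup>2 \<partial>P"
    have fL: "f \<in> L2_space P" using f by (simp add: L2_closed_span_def)
    have 1: "R \<le> (1 + t) * ?d" if t: "t > 0" for t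
    proof (rule field_le_epsilon)
      fix e :: real assume e: "e > 0"
      \<comment> \<open>the error made by \<open>g\<close> is to contribute at most \<open>e\<close> after multiplication by \<open>1 + 1 / t\<close>\<close>
      define \<epsilon> where "\<epsilon> = sqrt (e / (1 + 1 / t))"
      have "\<epsilon> > 0" using e t by (simp add: \<epsilon>_def add_pos_pos)
      then obtain g where g: "g \<in> lin_span S" "L2_dist P f g < \<epsilon>"
        using f unfolding L2_closed_span_def by blast
      have gL: "g \<in> L2_space P" using g lin_span_subset_L2[OF S] by auto
      have "(\<integral>\<omega>. (cmod (f \<omega> - g \<omega>))\<^sup>2 \<partial>P) < e / (1 + 1 / t)"
        using g(2) unfolding L2_dist_def \<epsilon>_def by simp
      then have "(1 + 1 / t) * (\<integral>\<omega>. (cmod (f \<omega> - g \<omega>))\<^sup>2 \<partial>P) \<le> (1 + 1 / t) * (e / (1 + 1 / t))"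
        using t by (intro mult_left_mono) auto
      also have "\<dots> = e"
      proof -
        have "1 + 1 / t \<noteq> 0" using t by (simp add: add_pos_pos less_imp_neq[symmetric])
        then show ?thesis by simp
      qed
      finally have 2: "(1 + 1 / t) * (\<integral>\<omega>. (cmod (f \<omega> - g \<omega>))\<^sup>2 \<partial>P) \<le> e" .
      have "R \<le> (\<integral>\<omega>. (cmod ((x \<omega> - f \<omega>) + (f \<omega> - g \<omega>)))\<^sup>2 \<partial>P)" using lower[OF g(1)] by simp
      also have "\<dots> \<le> (1 + t) * ?d + (1 + 1 / t) * (\<integral>\<omega>. (cmod (f \<omega> - g \<omega>))\<^sup>2 \<partial>P)"
        by (rule integral_cmod_square_add_le[OF L2_space_diff[OF x fL] L2_space_diff[OF fL gL] t])
      finally show "R \<le> (1 + t) * ?d + e" using 2 by simp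
    qed
    have "((\<lambda>t. (1 + t) * ?d) \<longlongrightarrow> (1 + 0) * ?d) (at_right 0)" by (intro tendsto_intros)
    then have "R \<le> (1 + 0) * ?d"
      by (rule tendsto_lowerbound) (auto simp: eventually_at_right_less 1 intro: eventually_mono[OF eventually_at_right_less])
    then show ?thesis by (simp add: L2_dist_def)
  qed
  obtain g0 where "g0 \<in> lin_span S" using upper[of 1] by auto
  then have ne: "L2_dist P x ` L2_closed_span P S \<noteq> {}" using span by auto
  have bdd: "bdd_below (L2_dist P x ` L2_closed_span P S)" by (rule bdd_belowI2[OF low])
  show ?thesis
  proof (rule antisym)
    show "sqrt R \<le> L2_setdist P x (L2_closed_span P S)"
      unfolding L2_setdist_def using ne low by (intro cINF_greatest) auto
    have "L2_setdist P x (L2_closed_span P S) \<le> sqrt (R + e)" if "e > 0" for e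
    proof -
      obtain g where g: "g \<in> lin_span S" "(\<integral>\<omega>. (cmod (x \<omega> - g \<omega>))\<^sup>2 \<partial>P) < R + e" using upper[OF \<open>e > 0\<close>] by auto
      have "L2_setdist P x (L2_closed_span P S) \<le> L2_dist P x g"
        unfolding L2_setdist_def using bdd g span by (intro cINF_lower) auto
      also have "\<dots> \<le> sqrt (R + e)" using g(2) by (simp add: L2_dist_def)
      finally show ?thesis .
    qed
    moreover have "((\<lambda>e. sqrt (R + e)) \<longlongrightarrow> sqrt (R + 0)) (at_right 0)" by (intro tendsto_intros)
    ultimately have "L2_setdist P x (L2_closed_span P S) \<le> sqrt (R + 0)"
      by (intro tendsto_lowerbound[where F="at_right 0"])
        (auto intro: eventually_mono[OF eventually_at_right_less])
    then show "L2_setdist P x (L2_closed_span P S) \<le> sqrt R" by simp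
  qed
qed

section \<open>The distance of the root from the other vertices\<close>

text \<open>
  Different vertices may carry the same random variable. A combination of random variables is turned
  into a combination of vertices by choosing one vertex for each of them.
\<close>

lemma lin_span_branches:
  "lin_span (X ` (tree_q1 q - {[]})) =
    {(\<lambda>\<omega>. \<Sum>i<q. \<Sum>k\<in>{1..N}. c i k * X (branch_ray i k) \<omega>) | c N. True}"
proof (intro equalityI subsetI)
  let ?br = "\<lambda>(i, k). branch_ray i k"
  fix f assume "f \<in> lin_span (X ` (tree_q1 q - {[]}))"
  then obtain F c where F: "finite F" "F \<subseteq> X ` (tree_q1 q - {[]})" and f: "f = (\<lambda>\<omega>. \<Sum>g\<in>F. c g * g \<omega>)"
    unfolding lin_span_def by blast
  obtain U where U: "U \<subseteq> tree_q1 q - {[]}" "inj_on X U" "F = X ` U"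
    using F(2) by (auto simp: subset_image_inj)
  have finU: "finite U" using F(1) U by (simp add: finite_image_iff)
  define N where "N = Max (insert 0 (length ` U))"
  define J where "J = {..<q} \<times> {1..N}"
  have len: "length \<sigma> \<le> N" if "\<sigma> \<in> U" for \<sigma> using that finU by (simp add: N_def)
  have UJ: "U \<subseteq> ?br ` J"
  proof
    fix \<sigma> assume \<sigma>: "\<sigma> \<in> U"
    then have "\<sigma> \<in> ?br ` ({..<q} \<times> {1..})" using U(1) unfolding tree_q1_minus_root by blast
    then obtain i k where "i < q" "1 \<le> k" "\<sigma> = branch_ray i k" by auto
    then show "\<sigma> \<in> ?br ` J" using len[OF \<sigma>] by (auto simp: J_def intro!: image_eqI[of _ _ "(i, k)"])
  qed
  have inj: "inj_on ?br J" by (rule inj_on_subset[OF inj_on_branch_ray]) (auto simp: J_def)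
  define d where "d \<sigma> = (if \<sigma> \<in> U then c (X \<sigma>) else 0)" for \<sigma>
  have "f \<omega> = (\<Sum>i<q. \<Sum>k\<in>{1..N}. d (branch_ray i k) * X (branch_ray i k) \<omega>)" for \<omega>
  proof -
    have "f \<omega> = (\<Sum>\<sigma>\<in>U. c (X \<sigma>) * X \<sigma> \<omega>)" unfolding f U(3) by (simp add: sum.reindex[OF U(2)])
    also have "\<dots> = (\<Sum>\<sigma>\<in>?br ` J. d \<sigma> * X \<sigma> \<omega>)"
      by (rule sum.mono_neutral_cong_left) (use UJ in \<open>auto simp: d_def J_def\<close>)
    also have "\<dots> = (\<Sum>(i, k)\<in>J. d (branch_ray i k) * X (branch_ray i k) \<omega>)"
      by (subst sum.reindex[OF inj]) (simp add: case_prod_unfold comp_def)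
    finally show ?thesis unfolding J_def by (simp add: sum.cartesian_product)
  qed
  then show "f \<in> {(\<lambda>\<omega>. \<Sum>i<q. \<Sum>k\<in>{1..N}. c i k * X (branch_ray i k) \<omega>) | c N. True}"
    by (intro CollectI exI[of _ "\<lambda>i k. d (branch_ray i k)"] exI[of _ N]) auto
next
  fix f assume "f \<in> {(\<lambda>\<omega>. \<Sum>i<q. \<Sum>k\<in>{1..N}. c i k * X (branch_ray i k) \<omega>) | c N. True}"
  then obtain c N where f: "f = (\<lambda>\<omega>. \<Sum>i<q. \<Sum>k\<in>{1..N}. c i k * X (branch_ray i k) \<omega>)" by auto
  have "f = (\<lambda>\<omega>. \<Sum>j\<in>{..<q} \<times> {1..N}. c (fst j) (snd j) * X (branch_ray (fst j) (snd j)) \<omega>)"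
    unfolding f by (simp add: sum.cartesian_product case_prod_unfold)
  also have "\<dots> \<in> lin_span (X ` (tree_q1 q - {[]}))"
  proof (rule lin_span_sum)
    fix j assume "j \<in> {..<q} \<times> {1..N}"
    then have "branch_ray (fst j) (snd j) \<in> tree_q1 q - {[]}"
      unfolding tree_q1_minus_root by (intro image_eqI[of _ _ j]) (auto simp: case_prod_unfold)
    then show "X (branch_ray (fst j) (snd j)) \<in> X ` (tree_q1 q - {[]})" by blast
  qed simp
  finally show "f \<in> lin_span (X ` (tree_q1 q - {[]}))" .
qed

text \<open>
  The spectral measure provides this for \<open>m \<le> n\<close>; conjugation gives the other case.
\<close>

lemma branch_covariance:
  assumes spec: "has_spectral_measure P (tree_q1 q) X \<mu>" and i: "i < q"
  shows "Cov P (X (branch_ray i m)) (X (branch_ray i n)) = Cov \<mu> (\<lambda>\<theta>. cis \<theta> ^ m) (\<lambda>\<theta>. cis \<theta> ^ n)"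
proof -
  have le: "Cov P (X (branch_ray i n)) (X (branch_ray i (n + k))) = Cov \<mu> (\<lambda>\<theta>. cis \<theta> ^ n) (\<lambda>\<theta>. cis \<theta> ^ (n + k))" for n k
  proof -
    have "cis \<theta> ^ n * cnj (cis \<theta> ^ (n + k)) = exp (- (\<i> * of_nat k * of_real \<theta>))" for \<theta>
    proof -
      have "cis \<theta> ^ n * cnj (cis \<theta> ^ (n + k)) = cis (- (real k * \<theta>))"
        unfolding Complex.DeMoivre cis_cnj cis_mult by (simp add: algebra_simps)
      then show ?thesis by (simp add: cis_conv_exp mult.assoc)
    qed
    then show ?thesis
      using spec branch_ray_rooted[OF i] unfolding has_spectral_measure_def is_spectral_measure_def Cov_def[of \<mu>] by simp
  qed
  show ?thesis
  proof (cases "m \<le> n")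
    case True
    then show ?thesis using le[of m "n - m"] by simp
  next
    case False
    then show ?thesis using le[of n "m - n"]
      by (subst (1 2) Cov_commute) simp
  qed
qed

text \<open>
  Kolmogorov's isometry: the variables on a ray and the powers of \<open>cis\<close> in \<open>L\<^sup>2(\<mu>)\<close> have the same
  Gram matrix.
\<close>

lemma branch_isometry:
  assumes spec: "has_spectral_measure P (tree_q1 q) X \<mu>" and \<mu>: "radon_measure_circle \<mu>" and i: "i < q"
    and L2: "\<And>\<sigma>. \<sigma> \<in> tree_q1 q \<Longrightarrow> X \<sigma> \<in> L2_space P"
  shows "(\<integral>\<omega>. (cmod (\<Sum>k\<le>N. a k * X (branch_ray i k) \<omega>))\<^sup>2 \<partial>P) =
    (\<integral>\<theta>. (cmod (poly (\<Sum>k\<le>N. monom (a k) k) (cis \<theta>)))\<^sup>2 \<partial>\<mu>)"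
proof -
  have cisL: "(\<lambda>\<theta>. cis \<theta> ^ k) \<in> L2_space \<mu>" for k
    using borel_measurable_poly_cis[OF \<mu>, of "monom 1 k"] integrable_poly_cis(2)[OF \<mu>, of "monom 1 k"]
    by (simp add: L2_space_def poly_monom)
  have "complex_of_real (\<integral>\<omega>. (cmod (\<Sum>k\<le>N. a k * X (branch_ray i k) \<omega>))\<^sup>2 \<partial>P) =
    (\<Sum>k\<le>N. \<Sum>l\<le>N. a k * cnj (a l) * Cov P (X (branch_ray i k)) (X (branch_ray i l)))"
    unfolding integral_cmod_square by (intro Cov_linear_combination L2 branch_ray_in_tree i)
  also have "\<dots> = (\<Sum>k\<le>N. \<Sum>l\<le>N. a k * cnj (a l) * Cov \<mu> (\<lambda>\<theta>. cis \<theta> ^ k) (\<lambda>\<theta>. cis \<theta> ^ l))"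
    by (simp add: branch_covariance[OF spec i])
  also have "\<dots> = complex_of_real (\<integral>\<theta>. (cmod (\<Sum>k\<le>N. a k * cis \<theta> ^ k))\<^sup>2 \<partial>\<mu>)"
    unfolding integral_cmod_square by (intro Cov_linear_combination[symmetric] cisL)
  finally show ?thesis
    by (simp only: of_real_eq_iff) (simp add: poly_sum poly_monom)
qed

text \<open>
  The polynomials on the right represent \<open>X e - g i\<close>, where \<open>g i\<close> is the part of the combination
  on ray \<open>i\<close>. They are exactly the polynomials of degree at most \<open>N\<close> with value \<open>1\<close> at \<open>0\<close>, chosen independently for
  each ray.
\<close>

lemma root_distance_to_branches:
  assumes q: "q > 0" and spec: "has_spectral_measure P (tree_q1 q) X \<mu>" and \<mu>: "radon_measure_circle \<mu>"
    and L2: "\<And>\<sigma>. \<sigma> \<in> tree_q1 q \<Longrightarrow> X \<sigma> \<in> L2_space P"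
    and orth: "\<And>\<sigma> \<tau>. \<sigma> \<in> tree_q1 q \<Longrightarrow> \<tau> \<in> tree_q1 q \<Longrightarrow> \<not> comparable (tree_q1 q) \<sigma> \<tau> \<Longrightarrow> Cov P (X \<sigma>) (X \<tau>) = 0"
  shows "(\<integral>\<omega>. (cmod (X [] \<omega> - (\<Sum>i<q. \<Sum>k\<in>{1..N}. c i k * X (branch_ray i k) \<omega>)))\<^sup>2 \<partial>P) =
    (\<Sum>i<q. \<integral>\<theta>. (cmod (poly (\<Sum>k\<le>N. monom (if k = 0 then 1 else - c i k) k) (cis \<theta>)))\<^sup>2 \<partial>\<mu>)
     - (real q - 1) * measure \<mu> (space \<mu>)"
proof -
  define g where "g i \<omega> = (\<Sum>k\<in>{1..N}. c i k * X (branch_ray i k) \<omega>)" for i \<omega>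
  have e: "X [] \<in> L2_space P" by (rule L2) (simp add: tree_q1_def)
  have g: "g i \<in> L2_space P" if "i < q" for i
    unfolding g_def[abs_def] by (intro L2_space_sum L2_space_cmult L2 branch_ray_in_tree that)
  have gg: "Cov P (g i) (g j) = 0" if "i < q" "j < q" "i \<noteq> j" for i j
  proof -
    have "Cov P (X (branch_ray i k)) (X (branch_ray j l)) = 0" if "k \<in> {1..N}" "l \<in> {1..N}" for k l
    proof -
      \<comment> \<open>\<open>k\<close> and \<open>l\<close> are at least \<open>1\<close>, so both vertices lie below the root\<close>
      have "\<not> comparable (tree_q1 q) (branch_ray i (Suc (k - 1))) (branch_ray j (Suc (l - 1)))"
        by (rule branches_not_comparable[OF \<open>i \<noteq> j\<close> q])
      then show ?thesis
        using that \<open>i < q\<close> \<open>j < q\<close> by (intro orth branch_ray_in_tree) (simp_all del: branch_ray_Suc)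
    qed
    then show ?thesis
      unfolding g_def[abs_def] using that
      by (subst Cov_linear_combination) (auto intro!: L2 branch_ray_in_tree sum.neutral)
  qed
  have e2: "(\<integral>\<omega>. (cmod (X [] \<omega>))\<^sup>2 \<partial>P) = measure \<mu> (space \<mu>)"
    using branch_isometry[OF spec \<mu> q L2, where a="\<lambda>_. 1" and N=0] by simp
  have eg: "(\<integral>\<omega>. (cmod (X [] \<omega> - g i \<omega>))\<^sup>2 \<partial>P) =
      (\<integral>\<theta>. (cmod (poly (\<Sum>k\<le>N. monom (if k = 0 then 1 else - c i k) k) (cis \<theta>)))\<^sup>2 \<partial>\<mu>)" if "i < q" for i
  proof -
    have "X [] \<omega> - g i \<omega> = (\<Sum>k\<le>N. (if k = 0 then 1 else - c i k) * X (branch_ray i k) \<omega>)" for \<omega>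
    proof -
      have "{..N} = insert 0 {1..N}" by auto
      then show ?thesis by (simp add: g_def sum_negf)
    qed
    then show ?thesis using branch_isometry[OF spec \<mu> that L2] by simp
  qed
  have "(\<integral>\<omega>. (cmod (X [] \<omega> - (\<Sum>i<q. g i \<omega>)))\<^sup>2 \<partial>P) = (\<integral>\<omega>. (cmod (X [] \<omega>))\<^sup>2 \<partial>P) +
    (\<Sum>i<q. (\<integral>\<omega>. (cmod (X [] \<omega> - g i \<omega>))\<^sup>2 \<partial>P) - (\<integral>\<omega>. (cmod (X [] \<omega>))\<^sup>2 \<partial>P))"
    using g gg by (intro orthogonal_sum_distance e) auto
  also have "\<dots> = measure \<mu> (space \<mu>) + (\<Sum>i<q.
      (\<integral>\<theta>. (cmod (poly (\<Sum>k\<le>N. monom (if k = 0 then 1 else - c i k) k) (cis \<theta>)))\<^sup>2 \<partial>\<mu>) - measure \<mu> (space \<mu>))"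
    by (simp add: e2 eg)
  also have "\<dots> = (\<Sum>i<q. \<integral>\<theta>. (cmod (poly (\<Sum>k\<le>N. monom (if k = 0 then 1 else - c i k) k) (cis \<theta>)))\<^sup>2 \<partial>\<mu>)
      - (real q - 1) * measure \<mu> (space \<mu>)"
    by (simp add: sum_subtractf left_diff_distrib)
  finally show ?thesis unfolding g_def .
qed

theorem proposition1p11:
  fixes q :: nat
    and P :: "'w measure"
    and X :: "nat list \<Rightarrow> 'w \<Rightarrow> complex"
    and \<mu> :: "real measure"
  assumes "q \<ge> 2"
    and "prob_space P"
    and "branching_stationary P (tree_q1 q) X"
    and "has_spectral_measure P (tree_q1 q) X \<mu>"
  shows "L2_setdist P (X []) (L2_closed_span P (X ` (tree_q1 q - {[]}))) =
    sqrt (real q * real_of_ereal (ext_exp (ext_integral haar_circle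
             (\<lambda>\<theta>. ext_log (RN_deriv haar_circle (ac_part haar_circle \<mu>) \<theta>))))
          - (real q - 1) * measure \<mu> (space \<mu>))"
proof -
  have q: "q > 0" using assms(1) by simp
  have \<mu>: "radon_measure_circle \<mu>"
    using assms(4) branch_ray_rooted[OF q] by (auto simp: has_spectral_measure_def is_spectral_measure_def)
  have L2: "X \<sigma> \<in> L2_space P" if "\<sigma> \<in> tree_q1 q" for \<sigma>
    using assms(3) that by (auto simp: branching_stationary_def mean_zero_L2_def)
  have orth: "Cov P (X \<sigma>) (X \<tau>) = 0"
    if "\<sigma> \<in> tree_q1 q" "\<tau> \<in> tree_q1 q" "\<not> comparable (tree_q1 q) \<sigma> \<tau>" for \<sigma> \<tau>
    using assms(3) that by (auto simp: branching_stationary_def)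
  note dist = root_distance_to_branches[OF q assms(4) \<mu> L2 orth]
  show ?thesis
    unfolding szego_constant_def[symmetric]
  proof (rule L2_setdist_closed_span)
    show "X ` (tree_q1 q - {[]}) \<subseteq> L2_space P" using L2 by auto
    show "X [] \<in> L2_space P" by (rule L2) (simp add: tree_q1_def)
  next
    fix g assume "g \<in> lin_span (X ` (tree_q1 q - {[]}))"
    then obtain c N where g: "g = (\<lambda>\<omega>. \<Sum>i<q. \<Sum>k\<in>{1..N}. c i k * X (branch_ray i k) \<omega>)"
      unfolding lin_span_branches by auto
    have "szego_constant \<mu> \<le> (\<integral>\<theta>. (cmod (poly (\<Sum>k\<le>N. monom (if k = 0 then 1 else - c i k) k) (cis \<theta>)))\<^sup>2 \<partial>\<mu>)" for i
      by (rule szego_lower_bound[OF \<mu>]) (simp add: poly_sum poly_monom power_0_left if_distrib[of "\<lambda>x. _ * x"] cong: if_cong)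
    then have "(\<Sum>i<q. szego_constant \<mu>) \<le>
        (\<Sum>i<q. \<integral>\<theta>. (cmod (poly (\<Sum>k\<le>N. monom (if k = 0 then 1 else - c i k) k) (cis \<theta>)))\<^sup>2 \<partial>\<mu>)"
      by (intro sum_mono)
    then show "real q * szego_constant \<mu> - (real q - 1) * measure \<mu> (space \<mu>)
        \<le> (\<integral>\<omega>. (cmod (X [] \<omega> - g \<omega>))\<^sup>2 \<partial>P)"
      unfolding g by (subst dist) simp_all
  next
    fix \<epsilon> :: real assume "\<epsilon> > 0"
    then obtain p where p: "poly p 0 = 1" "(\<integral>\<theta>. (cmod (poly p (cis \<theta>)))\<^sup>2 \<partial>\<mu>) < szego_constant \<mu> + \<epsilon> / real q"
      using szego_upper_bound[OF \<mu>, of "\<epsilon> / real q"] q by auto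
    define g where "g = (\<lambda>\<omega>. \<Sum>i<q. \<Sum>k\<in>{1..degree p}. (- coeff p k) * X (branch_ray i k) \<omega>)"
    have "(\<Sum>k\<le>degree p. monom (if k = 0 then 1 else - (- coeff p k)) k) = (\<Sum>k\<le>degree p. monom (coeff p k) k)"
      using p(1) by (intro sum.cong) (auto simp: poly_0_coeff_0)
    then have pp: "(\<Sum>k\<le>degree p. monom (if k = 0 then 1 else - (- coeff p k)) k) = p"
      by (simp only: poly_as_sum_of_monoms)
    have "(\<integral>\<omega>. (cmod (X [] \<omega> - g \<omega>))\<^sup>2 \<partial>P) =
        real q * (\<integral>\<theta>. (cmod (poly p (cis \<theta>)))\<^sup>2 \<partial>\<mu>) - (real q - 1) * measure \<mu> (space \<mu>)"
      unfolding g_def by (subst dist) (simp_all only: pp sum_constant card_lessThan not_False_eq_True)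
    also have "\<dots> < real q * (szego_constant \<mu> + \<epsilon> / real q) - (real q - 1) * measure \<mu> (space \<mu>)"
      using p(2) q by simp
    also have "\<dots> = real q * szego_constant \<mu> - (real q - 1) * measure \<mu> (space \<mu>) + \<epsilon>"
      using q by (simp add: distrib_left)
    finally have "(\<integral>\<omega>. (cmod (X [] \<omega> - g \<omega>))\<^sup>2 \<partial>P) < real q * szego_constant \<mu> - (real q - 1) * measure \<mu> (space \<mu>) + \<epsilon>" .
    moreover have "g \<in> lin_span (X ` (tree_q1 q - {[]}))"
      unfolding lin_span_branches g_def
      by (intro CollectI exI[of _ "\<lambda>i k. - coeff p k"] exI[of _ "degree p"]) simp
    ultimately show "\<exists>g\<in>lin_span (X ` (tree_q1 q - {[]})). (\<integral>\<omega>. (cmod (X [] \<omega> - g \<omega>))\<^sup>2 \<partial>P)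
        < real q * szego_constant \<mu> - (real q - 1) * measure \<mu> (space \<mu>) + \<epsilon>" by blast
  qed
qed

end
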